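(* Let $Y$ be a Banach sequence lattice, $X$ a Banach lattice and $E$ a Banach space. Then: (i) A linear operator $T:E\to X$ is $Y$-convex if and only if the associated operator $\widetilde{T}:\ell_{0}^{Y}(E)\to\ell_{0}^{\tau,Y}(X)$ is (well defined and) bounded, in which case $\|\widetilde{T}\|=\|T\|_{\mathcal{K}^{Y}}$. (ii) A linear operator $S:X\to E$ is $Y$-concave if and only if the associated operator $\widetilde{S}:\ell_{0}^{\tau,Y}(X)\to\ell_{0}^{Y}(E)$ is (well defined and) bounded, in which case $\|\widetilde{S}\|=\|S\|_{\mathcal{K}_{Y}}$.
   Context: All vector spaces are real. A Banach sequence lattice is a linear subspace $Y\subset\mathbb{R}^{\mathbb{N}}$ containing all canonical sequences $e_n$, with a complete norm $\|\cdot\|_Y$ such that if $f\in\mathbb{R}^{\mathbb{N}}$, $g\in Y$ and $|f|\le|g|$ pointwise, then $f\in Y$ and $\|f\|_Y\le\|g\|_Y$. A finite tuple $(t_1,\dots,t_n)\in\mathbb{R}^n$ is identified with $(t_1,\dots,t_n,0,0,\dots)\in Y$. Krivine's functional calculus: let $\mathcal{H}_n$ be the space of continuous $h:\mathbb{R}^n\to\mathbb{R}$ with $h(\lambda t)=\lambda h(t)$ for $\lambda\ge0$, with the pointwise order. For a Banach lattice $X$ and $x=(x_1,\dots,x_n)\in X^n$ there is a unique linear map $\tau_{n,x}:\mathcal{H}_n\to X$ with $\tau_{n,x}(\pi_{n,j})=x_j$ for each coordinate projection $\pi_{n,j}$ and $\tau_{n,x}(h_1\vee h_2)=\tau_{n,x}(h_1)\vee\tau_{n,x}(h_2)$.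 Write $\|(x_1,\dots,x_n)\|_Y:=\tau_{n,x}\big(t\mapsto\|(t_1,\dots,t_n)\|_Y\big)\in X$ and $\|(x_1,\dots,x_n)\|_{X^n,Y,\tau}:=\big\|\,\|(x_1,\dots,x_n)\|_Y\big\|_X\in\mathbb{R}$. For a Banach space $E$ write $\|(w_1,\dots,w_n)\|_{E^n,Y}:=\|(\|w_1\|_E,\dots,\|w_n\|_E)\|_Y$. A linear operator $T:E\to X$ is $Y$-convex if there is a constant $C>0$ with $\|(Tw_1,\dots,Tw_n)\|_{X^n,Y,\tau}\le C\|(w_1,\dots,w_n)\|_{E^n,Y}$ for all $n\in\mathbb{N}$, $w_1,\dots,w_n\in E$; the smallest such constant (infimum of all such $C$) is $\|T\|_{\mathcal{K}^Y}$. A linear operator $S:X\to E$ is $Y$-concave if there is $K>0$ with $\|(Sx_1,\dots,Sx_n)\|_{E^n,Y}\le K\|(x_1,\dots,x_n)\|_{X^n,Y,\tau}$ for all $n\in\mathbb{N}$, $x_1,\dots,x_n\in X$; the smallest such constant (infimum) is $\|S\|_{\mathcal{K}_Y}$. $\ell^{Y}(E):=\{\{w_j\}\in E^{\mathbb{N}}:\{\|w_j\|_E\}_j\in Y\}$ with norm $\|\{w_j\}\|_{\ell^Y(E)}:=\|\{\|w_j\|_E\}_{j}\|_Y$. $\ell^{\tau,Y}(X):=\{\{x_j\}\in X^{\mathbb{N}}:\sup_{n}\|(x_1,\dots,x_n)\|_{X^n,Y,\tau}<\infty\}$ with norm $\|\{x_j\}\|_{\ell^{\tau,Y}(X)}:=\sup_n\|(x_1,\dots,x_n)\|_{X^n,Y,\tau}$.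 $\ell_{0}^{Y}(E)$ and $\ell_{0}^{\tau,Y}(X)$ are the closures, in $\ell^{Y}(E)$ and $\ell^{\tau,Y}(X)$ respectively, of the subspaces of eventually zero sequences. For a linear operator $T:V\to W$ between vector spaces, the associated operator $\widetilde{T}:V^{\mathbb{N}}\to W^{\mathbb{N}}$ is $\widetilde{T}(\{v_j\}_{j=1}^\infty):=\{Tv_j\}_{j=1}^\infty$. Saying that $\widetilde{T}:A\to B$ is bounded, for normed spaces $A\subset V^{\mathbb{N}}$ and $B\subset W^{\mathbb{N}}$, means that $\widetilde{T}(A)\subset B$ and the restriction $A\to B$ is a bounded operator, whose norm is denoted $\|\widetilde{T}\|$. *)

theory Defs
  imports "HOL-Analysis.Analysis" "HOL-Library.Lattice_Algebras"
begin

section \<open>Banach lattices and Banach sequence lattices\<close>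

class banach_lattice = banach + ordered_real_vector + lattice_ab_group_add_abs +
  assumes norm_mono_abs: "\<bar>x\<bar> \<le> \<bar>y\<bar> \<Longrightarrow> norm x \<le> norm y"

instance real :: banach_lattice
  by standard simp

text \<open>Sequences are indexed from 0. The norm is a function on all real sequences, whose values
  outside \<open>Y\<close> are irrelevant.\<close>

locale banach_sequence_lattice =
  fixes Y :: "(nat \<Rightarrow> real) set" and normY :: "(nat \<Rightarrow> real) \<Rightarrow> real"
  assumes zero_mem: "(\<lambda>j. 0) \<in> Y"
    and add_mem: "f \<in> Y \<Longrightarrow> g \<in> Y \<Longrightarrow> (\<lambda>j. f j + g j) \<in> Y"
    and scale_mem: "f \<in> Y \<Longrightarrow> (\<lambda>j. c * f j) \<in> Y"
    and unit_mem: "(\<lambda>j. if j = i then 1 else 0) \<in> Y"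
    and norm_eq_zero: "f \<in> Y \<Longrightarrow> normY f = 0 \<longleftrightarrow> f = (\<lambda>j. 0)"
    and norm_scale: "f \<in> Y \<Longrightarrow> normY (\<lambda>j. c * f j) = \<bar>c\<bar> * normY f"
    and norm_triangle: "f \<in> Y \<Longrightarrow> g \<in> Y \<Longrightarrow> normY (\<lambda>j. f j + g j) \<le> normY f + normY g"
    and complete: "(\<And>k. F k \<in> Y) \<Longrightarrow>
        (\<And>\<epsilon>. \<epsilon> > 0 \<Longrightarrow> \<exists>M. \<forall>k\<ge>M. \<forall>l\<ge>M. normY (\<lambda>j. F k j - F l j) < \<epsilon>) \<Longrightarrow>
        \<exists>g\<in>Y. (\<lambda>k. normY (\<lambda>j. F k j - g j)) \<longlonglongrightarrow> 0"
    and solid_mem: "g \<in> Y \<Longrightarrow> (\<And>j. \<bar>f j\<bar> \<le> \<bar>g j\<bar>) \<Longrightarrow> f \<in> Y"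
    and solid_norm: "g \<in> Y \<Longrightarrow> (\<And>j. \<bar>f j\<bar> \<le> \<bar>g j\<bar>) \<Longrightarrow> normY f \<le> normY g"


section \<open>Krivine's functional calculus\<close>

text \<open>\<open>\<real>\<^sup>n\<close> is \<^const>\<open>Euclidean_space\<close> \<open>n\<close>, whose points are the real sequences vanishing from index \<open>n\<close> on.
  A function on \<open>\<real>\<^sup>n\<close> is represented by its extension by zero to all sequences, so that the
  space of functions below is closed under the pointwise operations and equality of functions on
  \<open>\<real>\<^sup>n\<close> is equality in HOL.\<close>

definition extend_zero :: "nat \<Rightarrow> ((nat \<Rightarrow> real) \<Rightarrow> real) \<Rightarrow> (nat \<Rightarrow> real) \<Rightarrow> real" where
  "extend_zero n h = (\<lambda>t. if t \<in> topspace (Euclidean_space n) then h t else 0)"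

definition krivine_functions :: "nat \<Rightarrow> ((nat \<Rightarrow> real) \<Rightarrow> real) set" where
  "krivine_functions n =
    {h. continuous_map (Euclidean_space n) euclideanreal h \<and>
        (\<forall>t\<in>topspace (Euclidean_space n). \<forall>c\<ge>0. h (\<lambda>j. c * t j) = c * h t) \<and>
        (\<forall>t. t \<notin> topspace (Euclidean_space n) \<longrightarrow> h t = 0)}"

text \<open>An \<open>n\<close>-tuple in \<open>X\<close> is given by the first \<open>n\<close> terms of a sequence; the later terms play no role.
  The last condition only normalises the total function \<open>\<tau>\<close> outside its domain, so that the
  functional calculus is unique.\<close>

definition is_krivine_calculus ::
    "nat \<Rightarrow> (nat \<Rightarrow> 'x::banach_lattice) \<Rightarrow> (((nat \<Rightarrow> real) \<Rightarrow> real) \<Rightarrow> 'x) \<Rightarrow> bool" where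
  "is_krivine_calculus n x \<tau> \<longleftrightarrow>
    (\<forall>g\<in>krivine_functions n. \<forall>h\<in>krivine_functions n. \<tau> (\<lambda>t. g t + h t) = \<tau> g + \<tau> h) \<and>
    (\<forall>h\<in>krivine_functions n. \<forall>c. \<tau> (\<lambda>t. c * h t) = c *\<^sub>R \<tau> h) \<and>
    (\<forall>j<n. \<tau> (extend_zero n (\<lambda>t. t j)) = x j) \<and>
    (\<forall>g\<in>krivine_functions n. \<forall>h\<in>krivine_functions n.
        \<tau> (\<lambda>t. sup (g t) (h t)) = sup (\<tau> g) (\<tau> h)) \<and>
    (\<forall>h. h \<notin> krivine_functions n \<longrightarrow> \<tau> h = 0)"

definition krivine ::
    "nat \<Rightarrow> (nat \<Rightarrow> 'x::banach_lattice) \<Rightarrow> ((nat \<Rightarrow> real) \<Rightarrow> real) \<Rightarrow> 'x" where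
  "krivine n x = (THE \<tau>. is_krivine_calculus n x \<tau>)"

definition tau_norm ::
    "((nat \<Rightarrow> real) \<Rightarrow> real) \<Rightarrow> nat \<Rightarrow> (nat \<Rightarrow> 'x::banach_lattice) \<Rightarrow> real" where
  "tau_norm normY n x = norm (krivine n x (extend_zero n normY))"

definition tuple_norm ::
    "((nat \<Rightarrow> real) \<Rightarrow> real) \<Rightarrow> nat \<Rightarrow> (nat \<Rightarrow> 'e::real_normed_vector) \<Rightarrow> real" where
  "tuple_norm normY n w = normY (\<lambda>j. if j < n then norm (w j) else 0)"


section \<open>Convex and concave operators\<close>

definition Y_convex_bound ::
    "((nat \<Rightarrow> real) \<Rightarrow> real) \<Rightarrow> ('e::banach \<Rightarrow> 'x::banach_lattice) \<Rightarrow> real \<Rightarrow> bool" where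
  "Y_convex_bound normY T C \<longleftrightarrow>
    C > 0 \<and> (\<forall>n w. tau_norm normY n (\<lambda>j. T (w j)) \<le> C * tuple_norm normY n w)"

definition Y_convex ::
    "((nat \<Rightarrow> real) \<Rightarrow> real) \<Rightarrow> ('e::banach \<Rightarrow> 'x::banach_lattice) \<Rightarrow> bool" where
  "Y_convex normY T \<longleftrightarrow> (\<exists>C. Y_convex_bound normY T C)"

definition Y_convex_const ::
    "((nat \<Rightarrow> real) \<Rightarrow> real) \<Rightarrow> ('e::banach \<Rightarrow> 'x::banach_lattice) \<Rightarrow> real" where
  "Y_convex_const normY T = Inf {C. Y_convex_bound normY T C}"

definition Y_concave_bound ::
    "((nat \<Rightarrow> real) \<Rightarrow> real) \<Rightarrow> ('x::banach_lattice \<Rightarrow> 'e::banach) \<Rightarrow> real \<Rightarrow> bool" where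
  "Y_concave_bound normY S K \<longleftrightarrow>
    K > 0 \<and> (\<forall>n x. tuple_norm normY n (\<lambda>j. S (x j)) \<le> K * tau_norm normY n x)"

definition Y_concave ::
    "((nat \<Rightarrow> real) \<Rightarrow> real) \<Rightarrow> ('x::banach_lattice \<Rightarrow> 'e::banach) \<Rightarrow> bool" where
  "Y_concave normY S \<longleftrightarrow> (\<exists>K. Y_concave_bound normY S K)"

definition Y_concave_const ::
    "((nat \<Rightarrow> real) \<Rightarrow> real) \<Rightarrow> ('x::banach_lattice \<Rightarrow> 'e::banach) \<Rightarrow> real" where
  "Y_concave_const normY S = Inf {K. Y_concave_bound normY S K}"


section \<open>Vector-valued sequence spaces\<close>

definition ell_norm ::
    "((nat \<Rightarrow> real) \<Rightarrow> real) \<Rightarrow> (nat \<Rightarrow> 'e::real_normed_vector) \<Rightarrow> real" where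
  "ell_norm normY w = normY (\<lambda>j. norm (w j))"

definition ell :: "(nat \<Rightarrow> real) set \<Rightarrow> (nat \<Rightarrow> 'e::real_normed_vector) set" where
  "ell Y = {w. (\<lambda>j. norm (w j)) \<in> Y}"

definition ell_tau_norm ::
    "((nat \<Rightarrow> real) \<Rightarrow> real) \<Rightarrow> (nat \<Rightarrow> 'x::banach_lattice) \<Rightarrow> real" where
  "ell_tau_norm normY x = (SUP n. tau_norm normY n x)"

definition ell_tau :: "((nat \<Rightarrow> real) \<Rightarrow> real) \<Rightarrow> (nat \<Rightarrow> 'x::banach_lattice) set" where
  "ell_tau normY = {x. bdd_above (range (\<lambda>n. tau_norm normY n x))}"

text \<open>Closure of the eventually zero sequences in the space \<open>A\<close> normed by \<open>N\<close>.\<close>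

definition closure_eventually_zero ::
    "(nat \<Rightarrow> 'a::real_vector) set \<Rightarrow> ((nat \<Rightarrow> 'a) \<Rightarrow> real) \<Rightarrow> (nat \<Rightarrow> 'a) set" where
  "closure_eventually_zero A N =
    {u\<in>A. \<forall>\<epsilon>>0. \<exists>v\<in>A. (\<forall>\<^sub>F j in sequentially. v j = 0) \<and> N (\<lambda>j. u j - v j) < \<epsilon>}"

definition ell0 ::
    "(nat \<Rightarrow> real) set \<Rightarrow> ((nat \<Rightarrow> real) \<Rightarrow> real) \<Rightarrow> (nat \<Rightarrow> 'e::real_normed_vector) set" where
  "ell0 Y normY = closure_eventually_zero (ell Y) (ell_norm normY)"

definition ell0_tau :: "((nat \<Rightarrow> real) \<Rightarrow> real) \<Rightarrow> (nat \<Rightarrow> 'x::banach_lattice) set" where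
  "ell0_tau normY = closure_eventually_zero (ell_tau normY) (ell_tau_norm normY)"


section \<open>Associated operators\<close>

definition seq_op :: "('v \<Rightarrow> 'w) \<Rightarrow> (nat \<Rightarrow> 'v) \<Rightarrow> (nat \<Rightarrow> 'w)" where
  "seq_op T v = (\<lambda>j. T (v j))"

text \<open>\<open>A\<close> and \<open>B\<close> are the domain and codomain, with norms \<open>NA\<close> and \<open>NB\<close>. Linearity is not part of
  the first definition: it is only used for \<^term>\<open>seq_op T\<close> with \<open>T\<close> linear. The second one
  is \<^const>\<open>onorm\<close> for a norm given by an explicit function on a set, with \<open>0 / 0 = 0\<close>.\<close>

definition bounded_between ::
    "'a set \<Rightarrow> ('a \<Rightarrow> real) \<Rightarrow> 'b set \<Rightarrow> ('b \<Rightarrow> real) \<Rightarrow> ('a \<Rightarrow> 'b) \<Rightarrow> bool" where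
  "bounded_between A NA B NB F \<longleftrightarrow> F ` A \<subseteq> B \<and> (\<exists>K. \<forall>a\<in>A. NB (F a) \<le> K * NA a)"

definition op_norm :: "'a set \<Rightarrow> ('a \<Rightarrow> real) \<Rightarrow> ('b \<Rightarrow> real) \<Rightarrow> ('a \<Rightarrow> 'b) \<Rightarrow> real" where
  "op_norm A NA NB F = (SUP a\<in>A. NB (F a) / NA a)"

end

(* A lattice identity valid in the reals is valid in every vector lattice: a finite infimum of linear
   forms is nowhere positive on R^n only if some convex combination of the forms vanishes (Gordan),
   and then the same infimum of elements of X lies below 0. Hence the values of lattice-linear
   expressions in x are well defined and monotone in the expression. These expressions are dense in
   the continuous homogeneous functions relative to the sum of the |t_k|, and X is complete, so the
   calculus exists and is unique. Uniqueness yields compatibility with substitutions, which shows that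
   the tau-norms of tuples are monotone in n, subadditive, and insensitive to appended zeros.

   The convexity (concavity) inequality for n-tuples is then the boundedness inequality on eventually
   zero sequences. In the convex case it passes to all sequences by taking suprema over truncations;
   in the concave case the image of a limit is found from the completeness of Y, and identified
   coordinatewise. *)

theory Submission
  imports Defs
begin

text \<open>The classical construction represents the ideal generated by the |x_k| as a C(K)-space
  and computes pointwise there. Gordan's alternative replaces that representation: its certificate
  is a relation between coefficient vectors, which makes sense in any vector lattice. The weight,
  the sum of the |t_k|, is chosen because it is itself a lattice-linear expression and equals 1 on a
  compact set meeting every ray. Uniform approximation on that set thus becomes an order bound by a
  multiple of the sum of the |x_k| in X, hence a norm bound.

  The two halves are not symmetric. Membership in the tau-space only asks for bounded truncations,
  whereas membership in \<open>Y\<close> does not follow from them: in c_0 the truncations of the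
  constant sequence 1 all have norm 1. A concave operator therefore needs convergence and not merely
  a bound. Equality of the norms comes from showing that both inequalities admit exactly the same
  positive constants.\<close>

section \<open>Gordan's alternative\<close>

text \<open>\<open>nat \<Rightarrow> real\<close> is not an instance of \<^class>\<open>real_vector\<close>, so subspaces and linear forms are
  spelled out.\<close>

definition closed_under_combinations :: "(nat \<Rightarrow> real) set \<Rightarrow> bool" where
  "closed_under_combinations V \<longleftrightarrow> V \<noteq> {} \<and> (\<forall>s\<in>V. \<forall>t\<in>V. \<forall>c. (\<lambda>k. s k + c * t k) \<in> V)"

definition linear_form_on :: "(nat \<Rightarrow> real) set \<Rightarrow> ((nat \<Rightarrow> real) \<Rightarrow> real) \<Rightarrow> bool" where
  "linear_form_on V f \<longleftrightarrow> (\<forall>s\<in>V. \<forall>t\<in>V. \<forall>c. f (\<lambda>k. s k + c * t k) = f s + c * f t)"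

lemma linear_form_on_subset: "linear_form_on V f \<Longrightarrow> W \<subseteq> V \<Longrightarrow> linear_form_on W f"
  unfolding linear_form_on_def by blast

lemma linear_form_on_sum:
  assumes "\<And>i. i \<in> I \<Longrightarrow> linear_form_on V (f i)"
  shows "linear_form_on V (\<lambda>t. \<Sum>i\<in>I. l i * f i t)"
  using assms unfolding linear_form_on_def
  by (simp add: sum.distrib sum_distrib_left algebra_simps)

text \<open>The induction step restricts the earlier forms to the kernel of the new one; a combination of
  them that vanishes there is a multiple of the new form.\<close>

lemma gordan_alternative:
  assumes "finite I" "closed_under_combinations V" "\<And>i. i \<in> I \<Longrightarrow> linear_form_on V (f i)"
  shows "(\<exists>t\<in>V. \<forall>i\<in>I. f i t > 0) \<or>
    (\<exists>l. (\<forall>i\<in>I. l i \<ge> 0) \<and> (\<exists>i\<in>I. l i \<noteq> 0) \<and> (\<forall>t\<in>V. (\<Sum>i\<in>I. l i * f i t) = 0))"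
  using assms
proof (induction I arbitrary: V rule: finite_induct)
  case empty
  then show ?case by (auto simp: closed_under_combinations_def)
next
  case (insert j I)
  let ?g = "f j"
  \<comment> \<open>A relation on \<open>I\<close> is completed by the weight \<open>c\<close> at
    the new index \<open>j\<close>; nontriviality is already ensured inside
    \<open>I\<close>.\<close>
  have extend: ?case if "\<forall>i\<in>I. l i \<ge> 0" "\<exists>i\<in>I. l i \<noteq> 0"
      "c \<ge> 0" "\<forall>t\<in>V. (\<Sum>i\<in>I. l i * f i t) + c * ?g t = 0" for l c
  proof -
    let ?l = "\<lambda>i. if i = j then c else l i"
    have "\<And>t. (\<Sum>i\<in>I. ?l i * f i t) = (\<Sum>i\<in>I. l i * f i t)"
      using insert.hyps by (intro sum.cong) auto
    moreover have "\<exists>i\<in>I. ?l i \<noteq> 0"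
      using that(2) insert.hyps(2) by metis
    ultimately show ?thesis
      using that insert.hyps by (intro disjI2 exI[of _ ?l]) (auto simp: add.commute)
  qed
  have lin: "linear_form_on V ?g" "\<And>i. i \<in> I \<Longrightarrow> linear_form_on V (f i)"
    using insert.prems by auto
  consider t where "t \<in> V" "\<forall>i\<in>I. f i t > 0"
    | l where "\<forall>i\<in>I. l i \<ge> 0" "\<exists>i\<in>I. l i \<noteq> 0" "\<forall>t\<in>V. (\<Sum>i\<in>I. l i * f i t) = 0"
    using insert.IH[OF insert.prems(1) lin(2)] by blast
  then show ?case
  proof cases
    case 2
    then show ?thesis using extend[of l 0] by simp
  next
    case (1 t0)
    show ?thesis
    proof (cases "\<forall>t\<in>V. ?g t = 0")
      case True
      then show ?thesis
        using insert.hyps by (intro disjI2 exI[of _ "\<lambda>i. if i = j then 1 else 0"])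
            (auto intro!: sum.neutral)
    next
      case False
      then obtain s0 where s0: "s0 \<in> V" "?g s0 \<noteq> 0" by auto
      \<comment> \<open>This is \<open>s0\<close> divided by \<open>?g s0\<close>, written as a sum
        because closure is available for combinations s + c * t.\<close>
      define s where "s = (\<lambda>k. s0 k + (1 / ?g s0 - 1) * s0 k)"
      have sV: "s \<in> V"
        using s0 insert.prems(1) unfolding closed_under_combinations_def s_def by blast
      have gs: "?g s = 1"
      proof -
        have "?g s = ?g s0 + (1 / ?g s0 - 1) * ?g s0"
          using lin(1) s0 unfolding linear_form_on_def s_def by blast
        then show ?thesis using s0 by (simp add: field_simps)
      qed
      let ?W = "{t\<in>V. ?g t = 0}"
      have split: "\<exists>w\<in>?W. t = (\<lambda>k. w k + ?g t * s k)" if "t \<in> V" for t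
      proof
        let ?w = "\<lambda>k. t k + (- ?g t) * s k"
        show "t = (\<lambda>k. ?w k + ?g t * s k)" by auto
        have "?w \<in> V" using that sV insert.prems(1) unfolding closed_under_combinations_def by blast
        moreover have "?g ?w = ?g t + (- ?g t) * ?g s"
          using lin(1) that sV unfolding linear_form_on_def by blast
        ultimately show "?w \<in> ?W" using gs by simp
      qed
      have "closed_under_combinations ?W"
        using insert.prems(1) lin(1) split[OF sV]
        unfolding closed_under_combinations_def linear_form_on_def by auto
      moreover have "linear_form_on ?W (f i)" if "i \<in> I" for i
        using lin(2)[OF that] by (rule linear_form_on_subset) auto
      ultimately consider t where "t \<in> ?W" "\<forall>i\<in>I. f i t > 0"
        | l where "\<forall>i\<in>I. l i \<ge> 0" "\<exists>i\<in>I. l i \<noteq> 0" "\<forall>t\<in>?W. (\<Sum>i\<in>I. l i * f i t) = 0"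
        using insert.IH[of ?W] by blast
      then show ?thesis
      proof cases
        case (1 t)
        \<comment> \<open>The kernel point \<open>t\<close> is pushed slightly in the direction
          \<open>s\<close>: the strict inequalities on \<open>I\<close> persist, and
          \<open>?g\<close> takes the value e > 0.\<close>
        have "\<forall>\<^sub>F e in at_right 0. \<forall>i\<in>I. 0 < f i t + e * f i s"
        proof (rule eventually_ball_finite[OF insert.hyps(1)], rule ballI)
          fix i assume "i \<in> I"
          have "((\<lambda>e. f i t + e * f i s) \<longlongrightarrow> f i t + 0 * f i s) (at_right 0)"
            by (intro tendsto_intros)
          then show "\<forall>\<^sub>F e in at_right 0. 0 < f i t + e * f i s"
            using 1 \<open>i \<in> I\<close> order_tendstoD(1) by fastforce
        qed
        moreover have "\<forall>\<^sub>F e in at_right (0::real). 0 < e"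
          by (simp add: eventually_at_right_less)
        ultimately have "\<forall>\<^sub>F e in at_right (0::real). 0 < e \<and> (\<forall>i\<in>I. 0 < f i t + e * f i s)"
          by eventually_elim simp
        then obtain e where e: "0 < e" "\<forall>i\<in>I. 0 < f i t + e * f i s"
          using eventually_happens'[OF trivial_limit_at_right_real] by blast
        have "(\<lambda>k. t k + e * s k) \<in> V"
          using 1 sV insert.prems(1) unfolding closed_under_combinations_def by blast
        moreover have "f i (\<lambda>k. t k + e * s k) = f i t + e * f i s" if "i \<in> insert j I" for i
          using insert.prems(2)[OF that] 1 sV unfolding linear_form_on_def by blast
        ultimately show ?thesis
          using e 1 gs by (intro disjI1 bexI[of _ "\<lambda>k. t k + e * s k"]) auto
      next
        case (2 l)
        define c where "c = (\<Sum>i\<in>I. l i * f i s)"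
        have eq: "(\<Sum>i\<in>I. l i * f i t) = c * ?g t" if "t \<in> V" for t
        proof -
          obtain w where w: "w \<in> ?W" "t = (\<lambda>k. w k + ?g t * s k)"
            using split[OF \<open>t \<in> V\<close>] by blast
          have "linear_form_on V (\<lambda>t. \<Sum>i\<in>I. l i * f i t)"
            using lin(2) by (rule linear_form_on_sum)
          then have "(\<Sum>i\<in>I. l i * f i (\<lambda>k. w k + ?g t * s k))
              = (\<Sum>i\<in>I. l i * f i w) + ?g t * c"
            using w(1) sV unfolding linear_form_on_def c_def by blast
          then show ?thesis using w 2 by simp
        qed
        \<comment> \<open>On \<open>V\<close> the combination equals \<open>c * ?g\<close>. If c
          \<le> 0, the weight \<open>- c\<close> at \<open>j\<close> gives a relation. Otherwise the
          combination is positive at \<open>t0\<close>, hence so is \<open>?g\<close>, and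
          \<open>t0\<close> makes all forms positive.\<close>
        show ?thesis
        proof (cases "c \<le> 0")
          case True
          then show ?thesis using extend[of l "- c"] 2 eq by simp
        next
          case False
          obtain i where i: "i \<in> I" "l i \<noteq> 0" using 2 by blast
          have "0 < (\<Sum>i\<in>I. l i * f i t0)"
            using 1 2 i insert.hyps(1) by (intro sum_pos2[of _ i]) (auto simp: less_le)
          then have "?g t0 > 0"
            using eq[OF 1(1)] False by (simp add: zero_less_mult_iff)
          then show ?thesis using 1 by auto
        qed
      qed
    qed
  qed
qed

section \<open>Lattice-linear functions\<close>

text \<open>The pairs \<open>(f, y)\<close> below are the values of one lattice-linear expression at the coordinates of
  \<open>\<real>\<^sup>n\<close> and at \<open>x\<close>. Finite suprema of finite infima of linear forms exhaust these expressions
  by distributivity, and this normal form is what makes the sign of \<open>y\<close> accessible.\<close>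

inductive meet_linear ::
    "nat \<Rightarrow> (nat \<Rightarrow> 'x::banach_lattice) \<Rightarrow> ((nat \<Rightarrow> real) \<Rightarrow> real) \<Rightarrow> 'x \<Rightarrow> bool"
  for n x where
    linear: "meet_linear n x (\<lambda>t. \<Sum>k<n. a k * t k) (\<Sum>k<n. a k *\<^sub>R x k)"
  | inf: "meet_linear n x f y \<Longrightarrow> meet_linear n x g z \<Longrightarrow>
      meet_linear n x (\<lambda>t. inf (f t) (g t)) (inf y z)"

inductive lattice_linear ::
    "nat \<Rightarrow> (nat \<Rightarrow> 'x::banach_lattice) \<Rightarrow> ((nat \<Rightarrow> real) \<Rightarrow> real) \<Rightarrow> 'x \<Rightarrow> bool"
  for n x where
    meet: "meet_linear n x f y \<Longrightarrow> lattice_linear n x f y"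
  | sup: "lattice_linear n x f y \<Longrightarrow> lattice_linear n x g z \<Longrightarrow>
      lattice_linear n x (\<lambda>t. sup (f t) (g t)) (sup y z)"

text \<open>Lattice-ordered groups are distributive because inf u c = u + (c - sup u c). For u = sup
  a b the bracket is \<open>d\<close>; translation by \<open>d\<close> passes through the supremum,
  and for smaller u the bracket only grows.\<close>

lemma inf_sup_distrib_right_group:
  fixes a b c :: "'x::lattice_ab_group_add"
  shows "inf (sup a b) c = sup (inf a c) (inf b c)"
proof (rule antisym)
  define d where "d = c - sup (sup a b) c"
  have *: "u + d \<le> inf u c" if "u \<le> sup a b" for u
  proof -
    have "sup u c \<le> sup (sup a b) c" using that by (rule sup_mono) simp
    then have "u + d \<le> u + (c - sup u c)" unfolding d_def by (intro add_left_mono diff_left_mono)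
    also have "\<dots> = inf u c" using add_eq_inf_sup[of u c] by (simp only: algebra_simps)
    finally show ?thesis .
  qed
  have "inf (sup a b) c = sup a b + d"
    using add_eq_inf_sup[of "sup a b" c] unfolding d_def by (simp only: algebra_simps)
  also have "\<dots> = sup (a + d) (b + d)"
    by (rule add_sup_distrib_right)
  also have "\<dots> \<le> sup (inf a c) (inf b c)"
    using *[of a] *[of b] by (intro sup_mono) simp_all
  finally show "inf (sup a b) c \<le> sup (inf a c) (inf b c)" .
qed (auto intro: le_infI1)

lemma inf_sup_distrib_left_group:
  fixes a b c :: "'x::lattice_ab_group_add"
  shows "inf c (sup a b) = sup (inf c a) (inf c b)"
  using inf_sup_distrib_right_group[of a b c] by (simp only: inf_commute[of c])

lemma scaleR_inf_distrib:
  fixes y z :: "'x::banach_lattice"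
  assumes "c \<ge> 0"
  shows "c *\<^sub>R inf y z = inf (c *\<^sub>R y) (c *\<^sub>R z)"
proof (cases "c = 0")
  case False
  show ?thesis
  proof (rule antisym)
    show "c *\<^sub>R inf y z \<le> inf (c *\<^sub>R y) (c *\<^sub>R z)"
      using assms by (simp add: scaleR_left_mono)
    have "inverse c *\<^sub>R inf (c *\<^sub>R y) (c *\<^sub>R z) \<le> inf (inverse c *\<^sub>R c *\<^sub>R y) (inverse c *\<^sub>R c *\<^sub>R z)"
      using assms by (intro inf_greatest scaleR_left_mono) auto
    also have "\<dots> = inf y z" using False by simp
    finally have "c *\<^sub>R inverse c *\<^sub>R inf (c *\<^sub>R y) (c *\<^sub>R z) \<le> c *\<^sub>R inf y z"
      using assms by (intro scaleR_left_mono) auto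
    then show "inf (c *\<^sub>R y) (c *\<^sub>R z) \<le> c *\<^sub>R inf y z" using False by simp
  qed
qed simp

lemma scaleR_sup_distrib:
  fixes y z :: "'x::banach_lattice"
  assumes "c \<ge> 0"
  shows "c *\<^sub>R sup y z = sup (c *\<^sub>R y) (c *\<^sub>R z)"
  using scaleR_inf_distrib[OF assms, of "- y" "- z"]
  by (simp only: sup_eq_neg_inf scaleR_minus_right)

section \<open>Closure of lattice-linear pairs under the vector lattice operations\<close>

text \<open>Translations commute with infima, in the reals and in X alike, so the sum of two meets
  is the meet of all sums of their forms. The same identity rewrites both components of the pair,
  here and in the following lemmas.\<close>

lemma meet_linear_add:
  assumes "meet_linear n x f y" "meet_linear n x g z"
  shows "meet_linear n x (\<lambda>t. f t + g t) (y + z)"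
  using assms
proof (induction arbitrary: g z)
  case (linear a)
  from linear show ?case
  proof induction
    case (linear b)
    then show ?case
      using meet_linear.linear[of n x "\<lambda>k. a k + b k"]
      by (simp add: sum.distrib algebra_simps)
  next
    case (inf f y g z)
    from meet_linear.inf[OF inf.IH] show ?case by (simp only: add_inf_distrib_left)
  qed
next
  case (inf f y f' y')
  from meet_linear.inf[OF inf.IH(1)[OF inf.prems] inf.IH(2)[OF inf.prems]]
  show ?case by (simp only: add_inf_distrib_right)
qed

lemma lattice_linear_add:
  assumes "lattice_linear n x f y" "lattice_linear n x g z"
  shows "lattice_linear n x (\<lambda>t. f t + g t) (y + z)"
  using assms
proof (induction arbitrary: g z)
  case (meet f y)
  from meet.prems show ?case
  proof induction
    case (meet g z)
    then show ?case using \<open>meet_linear n x f y\<close> meet_linear_add lattice_linear.meet by blast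
  next
    case (sup f y g z)
    from lattice_linear.sup[OF sup.IH] show ?case by (simp only: add_sup_distrib_left)
  qed
next
  case (sup f y f' y')
  from lattice_linear.sup[OF sup.IH(1)[OF sup.prems] sup.IH(2)[OF sup.prems]]
  show ?case by (simp only: add_sup_distrib_right)
qed

lemma lattice_linear_inf:
  assumes "lattice_linear n x f y" "lattice_linear n x g z"
  shows "lattice_linear n x (\<lambda>t. inf (f t) (g t)) (inf y z)"
  using assms
proof (induction arbitrary: g z)
  case (meet f y)
  from meet.prems show ?case
  proof induction
    case (meet g z)
    then show ?case using \<open>meet_linear n x f y\<close> meet_linear.inf lattice_linear.meet by blast
  next
    case (sup f y g z)
    from lattice_linear.sup[OF sup.IH] show ?case
      by (simp only: inf_sup_distrib_left_group)
  qed
next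
  case (sup f y f' y')
  from lattice_linear.sup[OF sup.IH(1)[OF sup.prems] sup.IH(2)[OF sup.prems]]
  show ?case by (simp only: inf_sup_distrib_right_group)
qed

lemma meet_linear_scale_nonneg:
  assumes "meet_linear n x f y" "c \<ge> 0"
  shows "meet_linear n x (\<lambda>t. c * f t) (c *\<^sub>R y)"
  using assms(1)
proof induction
  case (linear a)
  show ?case
    using meet_linear.linear[of n x "\<lambda>k. c * a k"]
    by (simp add: sum_distrib_left scaleR_sum_right mult.assoc)
next
  case (inf f y g z)
  from meet_linear.inf[OF inf.IH] show ?case
    using scaleR_inf_distrib[OF assms(2), where 'x=real] scaleR_inf_distrib[OF assms(2), where 'x='a]
    by simp
qed

lemma lattice_linear_scale_nonneg:
  assumes "lattice_linear n x f y" "c \<ge> 0"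
  shows "lattice_linear n x (\<lambda>t. c * f t) (c *\<^sub>R y)"
  using assms(1)
proof induction
  case (meet f y)
  then show ?case using meet_linear_scale_nonneg[OF _ assms(2)] lattice_linear.meet by blast
next
  case (sup f y g z)
  from lattice_linear.sup[OF sup.IH] show ?case
    using scaleR_sup_distrib[OF assms(2), where 'x=real] scaleR_sup_distrib[OF assms(2), where 'x='a]
    by simp
qed

text \<open>Negation turns a supremum of infima into an infimum of suprema;
  \<open>lattice_linear_inf\<close>, that is distributivity, restores the normal form.\<close>

lemma lattice_linear_uminus:
  assumes "lattice_linear n x f y"
  shows "lattice_linear n x (\<lambda>t. - f t) (- y)"
  using assms
proof induction
  case (meet f y)
  then show ?case
  proof induction
    case (linear a)
    show ?case
      using lattice_linear.meet[OF meet_linear.linear[of n x "\<lambda>k. - a k"]]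
      by (simp add: sum_negf)
  next
    case (inf f y g z)
    from lattice_linear.sup[OF inf.IH] show ?case by (simp only: neg_inf_eq_sup)
  qed
next
  case (sup f y g z)
  from lattice_linear_inf[OF sup.IH] show ?case by (simp only: neg_sup_eq_inf)
qed

lemma lattice_linear_diff:
  "lattice_linear n x f y \<Longrightarrow> lattice_linear n x g z \<Longrightarrow> lattice_linear n x (\<lambda>t. f t - g t) (y - z)"
  using lattice_linear_add[OF _ lattice_linear_uminus] by fastforce

lemma lattice_linear_scale:
  assumes "lattice_linear n x f y"
  shows "lattice_linear n x (\<lambda>t. c * f t) (c *\<^sub>R y)"
proof (cases "c \<ge> 0")
  case False
  then show ?thesis
    using lattice_linear_uminus[OF lattice_linear_scale_nonneg[OF assms, of "- c"]] by simp
qed (simp add: lattice_linear_scale_nonneg assms)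

lemma lattice_linear_abs:
  assumes "lattice_linear n x f y"
  shows "lattice_linear n x (\<lambda>t. \<bar>f t\<bar>) \<bar>y\<bar>"
  using lattice_linear.sup[OF assms lattice_linear_uminus[OF assms]] by (simp only: abs_lattice)

lemma lattice_linear_zero: "lattice_linear n x (\<lambda>t. 0) 0"
  using lattice_linear.meet[OF meet_linear.linear[of n x "\<lambda>_. 0"]] by simp

lemma lattice_linear_sum:
  assumes "\<And>i. i \<in> I \<Longrightarrow> lattice_linear n x (f i) (y i)"
  shows "lattice_linear n x (\<lambda>t. \<Sum>i\<in>I. f i t) (\<Sum>i\<in>I. y i)"
  using assms by (induction I rule: infinite_finite_induct)
     (auto simp: lattice_linear_zero intro: lattice_linear_add)

lemma lattice_linear_coord:
  assumes "j < n"
  shows "lattice_linear n x (\<lambda>t. t j) (x j)"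
proof -
  have "(\<Sum>k<n. (if k = j then 1 else 0) * t k) = t j" for t :: "nat \<Rightarrow> real"
    using assms by (simp add: if_distrib[of "\<lambda>u. u * _"] cong: if_cong)
  moreover have "(\<Sum>k<n. (if k = j then 1 else 0) *\<^sub>R x k) = x j"
    using assms by (simp add: if_distrib[of "\<lambda>u. u *\<^sub>R _"] cong: if_cong)
  ultimately show ?thesis
    using lattice_linear.meet[OF meet_linear.linear[of n x "\<lambda>k. if k = j then 1 else 0"]] by simp
qed

lemma lattice_linear_homogeneous:
  assumes "lattice_linear n x f y" "c \<ge> 0"
  shows "f (\<lambda>j. c * t j) = c * f t"
  using assms(1)
proof induction
  case (meet f y)
  then show ?case
  proof induction
    case (linear a)
    then show ?case by (simp add: sum_distrib_left algebra_simps)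
  next
    case (inf f y g z)
    then show ?case
      using scaleR_inf_distrib[OF assms(2), where 'x=real] by simp
  qed
next
  case (sup f y g z)
  then show ?case
      using scaleR_sup_distrib[OF assms(2), where 'x=real] by simp
qed

lemma lattice_linear_continuous:
  assumes "lattice_linear n x f y"
  shows "continuous_on A f"
  using assms
proof induction
  case (meet f y)
  then show ?case
  proof induction
    case (linear a)
    then show ?case
      by (intro continuous_intros continuous_on_product_then_coordinatewise[OF continuous_on_id])
  next
    case (inf f y g z)
    then show ?case unfolding inf_min by (intro continuous_intros)
  qed
next
  case (sup f y g z)
  then show ?case unfolding sup_max by (intro continuous_intros)
qed

section \<open>Transfer of inequalities from the reals to X\<close>

text \<open>\<open>A\<close> collects the coefficient vectors of the forms in the meet. Of the two
  descriptions of the pair as a minimum only one half each is kept: a lower bound for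
  \<open>f\<close>, an upper bound for \<open>y\<close>.\<close>

lemma meet_linear_forms:
  assumes "meet_linear n x f y"
  shows "\<exists>A. finite A \<and> A \<noteq> {} \<and>
    (\<forall>t. (\<forall>a\<in>A. (\<Sum>k<n. a k * t k) > 0) \<longrightarrow> f t > 0) \<and> (\<forall>a\<in>A. y \<le> (\<Sum>k<n. a k *\<^sub>R x k))"
  using assms
proof induction
  case (linear a)
  then show ?case by (intro exI[of _ "{a}"]) auto
next
  case (inf f y g z)
  then obtain A B where "finite A \<and> A \<noteq> {} \<and>
    (\<forall>t. (\<forall>a\<in>A. (\<Sum>k<n. a k * t k) > 0) \<longrightarrow> f t > 0) \<and> (\<forall>a\<in>A. y \<le> (\<Sum>k<n. a k *\<^sub>R x k))"
    "finite B \<and> B \<noteq> {} \<and>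
    (\<forall>t. (\<forall>a\<in>B. (\<Sum>k<n. a k * t k) > 0) \<longrightarrow> g t > 0) \<and> (\<forall>a\<in>B. z \<le> (\<Sum>k<n. a k *\<^sub>R x k))"
    by blast
  then show ?case
    by (intro exI[of _ "A \<union> B"]) (auto intro: le_infI1 le_infI2 simp: inf_min)
qed

text \<open>A meet of linear forms is nowhere positive only if some convex combination of these forms
  vanishes, and the meet lies below every such combination in any vector lattice.\<close>

lemma meet_linear_nonpos:
  assumes "meet_linear n x f y" "\<And>t. t \<in> topspace (Euclidean_space n) \<Longrightarrow> f t \<le> 0"
  shows "y \<le> 0"
proof -
  obtain A where A: "finite A" "A \<noteq> {}"
    "\<And>t. (\<forall>a\<in>A. (\<Sum>k<n. a k * t k) > 0) \<Longrightarrow> f t > 0" "\<And>a. a \<in> A \<Longrightarrow> y \<le> (\<Sum>k<n. a k *\<^sub>R x k)"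
    using meet_linear_forms[OF assms(1)] by blast
  let ?V = "topspace (Euclidean_space n)"
  have "closed_under_combinations ?V"
    by (auto simp: closed_under_combinations_def topspace_Euclidean_space)
  moreover have "linear_form_on ?V (\<lambda>t. \<Sum>k<n. a k * t k)" for a
    by (simp add: linear_form_on_def sum.distrib sum_distrib_left algebra_simps)
  moreover have "\<not> (\<exists>t\<in>?V. \<forall>a\<in>A. (\<Sum>k<n. a k * t k) > 0)"
    using A(3) assms(2) by (meson not_less)
  ultimately obtain l where l: "\<forall>a\<in>A. l a \<ge> 0" "\<exists>a\<in>A. l a \<noteq> 0"
      "\<forall>t\<in>?V. (\<Sum>a\<in>A. l a * (\<Sum>k<n. a k * t k)) = 0"
    using gordan_alternative[OF A(1), of ?V "\<lambda>a t. \<Sum>k<n. a k * t k"] by blast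
  \<comment> \<open>Evaluation at the unit vectors turns a vanishing form on R^n into vanishing
    coefficients, which can then be applied to the elements \<open>x k\<close>.\<close>
  have coeff: "(\<Sum>a\<in>A. l a * a j) = 0" if "j < n" for j
  proof -
    have "(\<lambda>k. if k = j then 1 else 0) \<in> ?V"
      using that by (simp add: topspace_Euclidean_space)
    moreover have "(\<Sum>k<n. a k * (if k = j then 1 else 0)) = a j" for a :: "nat \<Rightarrow> real"
      using that by (simp add: if_distrib cong: if_cong)
    ultimately show ?thesis using l(3) by fastforce
  qed
  have "(\<Sum>a\<in>A. l a) *\<^sub>R y = (\<Sum>a\<in>A. l a *\<^sub>R y)"
    by (rule scaleR_left.sum)
  also have "\<dots> \<le> (\<Sum>a\<in>A. l a *\<^sub>R (\<Sum>k<n. a k *\<^sub>R x k))"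
    using l A by (intro sum_mono scaleR_left_mono) auto
  also have "\<dots> = (\<Sum>k<n. (\<Sum>a\<in>A. l a * a k) *\<^sub>R x k)"
    unfolding scaleR_sum_right scaleR_left.sum by (subst sum.swap) simp
  also have "\<dots> = 0" using coeff by simp
  finally have le: "(\<Sum>a\<in>A. l a) *\<^sub>R y \<le> 0" .
  have pos: "(\<Sum>a\<in>A. l a) > 0"
  proof -
    obtain a where "a \<in> A" "l a \<noteq> 0" using l(2) by blast
    then show ?thesis using l(1) A(1) by (intro sum_pos2[of _ a]) (auto simp: less_le)
  qed
  then have "inverse (\<Sum>a\<in>A. l a) *\<^sub>R (\<Sum>a\<in>A. l a) *\<^sub>R y \<le> inverse (\<Sum>a\<in>A. l a) *\<^sub>R 0"
    using le by (intro scaleR_left_mono) auto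
  then show ?thesis using pos by simp
qed

text \<open>A supremum is nonpositive exactly when both members are, pointwise as well as in X. This
  is why suprema stand outermost in the normal form.\<close>

lemma lattice_linear_nonpos:
  assumes "lattice_linear n x f y" "\<And>t. t \<in> topspace (Euclidean_space n) \<Longrightarrow> f t \<le> 0"
  shows "y \<le> 0"
  using assms
proof induction
  case (meet f y)
  then show ?case by (rule meet_linear_nonpos)
next
  case (sup f y g z)
  then show ?case by simp
qed

text \<open>The transfer principle: apply the sign criterion to the difference. In particular
  \<open>y\<close> is determined by the restriction of \<open>f\<close> to R^n.\<close>

lemma lattice_linear_mono:
  assumes "lattice_linear n x f y" "lattice_linear n x g z"
    and "\<And>t. t \<in> topspace (Euclidean_space n) \<Longrightarrow> f t \<le> g t"
  shows "y \<le> z"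
  using lattice_linear_nonpos[OF lattice_linear_diff[OF assms(1,2)]] assms(3) by simp

section \<open>Uniform approximation by lattice-linear functions\<close>

lemma norm_abs_banach_lattice [simp]: "norm \<bar>x :: 'x::banach_lattice\<bar> = norm x"
  by (simp add: antisym norm_mono_abs)

lemma norm_mono_nonneg:
  fixes x y :: "'x::banach_lattice"
  shows "0 \<le> x \<Longrightarrow> x \<le> y \<Longrightarrow> norm x \<le> norm y"
  by (rule norm_mono_abs) simp

text \<open>From a \<le> |a - c| + c one gets a \<le> |a - c| + sup c d, and likewise for
  \<open>b\<close>; exchanging the two pairs gives the other sign. It makes approximation compatible
  with suprema.\<close>

lemma abs_sup_diff_le:
  fixes a b c d :: "'x::lattice_ab_group_add_abs"
  shows "\<bar>sup a b - sup c d\<bar> \<le> \<bar>a - c\<bar> + \<bar>b - d\<bar>"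
proof -
  have *: "sup a b - sup c d \<le> \<bar>a - c\<bar> + \<bar>b - d\<bar>" for a b c d :: 'x
  proof -
    have "a \<le> (\<bar>a - c\<bar> + \<bar>b - d\<bar>) + sup c d"
    proof -
      have "a = (a - c) + c" by simp
      also have "\<dots> \<le> \<bar>a - c\<bar> + sup c d" by (intro add_mono abs_ge_self) simp
      also have "\<dots> \<le> (\<bar>a - c\<bar> + \<bar>b - d\<bar>) + sup c d" by (intro add_right_mono) simp
      finally show ?thesis .
    qed
    moreover have "b \<le> (\<bar>a - c\<bar> + \<bar>b - d\<bar>) + sup c d"
    proof -
      have "b = (b - d) + d" by simp
      also have "\<dots> \<le> \<bar>b - d\<bar> + sup c d" by (intro add_mono abs_ge_self) simp
      also have "\<dots> \<le> (\<bar>a - c\<bar> + \<bar>b - d\<bar>) + sup c d" by (intro add_right_mono) simp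
      finally show ?thesis .
    qed
    ultimately show ?thesis by (simp only: diff_le_eq le_sup_iff)
  qed
  show ?thesis
    using *[of a b c d] *[of c d a b] by (intro abs_leI) (simp_all only: minus_diff_eq abs_minus_commute)
qed

lemma norm_sup_diff_le:
  fixes a b c d :: "'x::banach_lattice"
  shows "norm (sup a b - sup c d) \<le> norm (a - c) + norm (b - d)"
proof -
  have "norm (sup a b - sup c d) \<le> norm (\<bar>a - c\<bar> + \<bar>b - d\<bar>)"
    by (rule norm_mono_abs) (use abs_sup_diff_le[of a b c d] in simp)
  also have "\<dots> \<le> norm (a - c) + norm (b - d)"
    using norm_triangle_ineq[of "\<bar>a - c\<bar>" "\<bar>b - d\<bar>"] by simp
  finally show ?thesis .
qed

text \<open>The bound on the right of the hypothesis is itself lattice-linear, so it transfers to an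
  order bound in X, and the norm of X is monotone. This converts uniform closeness of functions into
  closeness of values.\<close>

lemma lattice_linear_norm_diff_le:
  assumes "lattice_linear n x f y" "lattice_linear n x g z" "c \<ge> 0"
    and "\<And>t. t \<in> topspace (Euclidean_space n) \<Longrightarrow> \<bar>f t - g t\<bar> \<le> c * (\<Sum>k<n. \<bar>t k\<bar>)"
  shows "norm (y - z) \<le> c * norm (\<Sum>k<n. \<bar>x k\<bar>)"
proof -
  have "lattice_linear n x (\<lambda>t. c * (\<Sum>k<n. \<bar>t k\<bar>)) (c *\<^sub>R (\<Sum>k<n. \<bar>x k\<bar>))"
    by (intro lattice_linear_scale lattice_linear_sum lattice_linear_abs lattice_linear_coord) simp
  then have "\<bar>y - z\<bar> \<le> c *\<^sub>R (\<Sum>k<n. \<bar>x k\<bar>)"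
    by (rule lattice_linear_mono[OF lattice_linear_abs[OF lattice_linear_diff[OF assms(1,2)]]])
       (rule assms(4))
  then have "norm \<bar>y - z\<bar> \<le> norm (c *\<^sub>R (\<Sum>k<n. \<bar>x k\<bar>))"
    by (intro norm_mono_nonneg) auto
  then show ?thesis using assms(3) by simp
qed

lemma lattice_linear_finite_Inf:
  assumes "finite C" "C \<noteq> {}" "\<And>s. s \<in> C \<Longrightarrow> \<exists>z. lattice_linear n x (F s) z"
  shows "\<exists>f z. lattice_linear n x f z \<and> (\<forall>t. (\<exists>s\<in>C. f t = F s t) \<and> (\<forall>s\<in>C. f t \<le> F s t))"
  using assms
proof (induction C rule: finite_ne_induct)
  case (singleton s)
  then obtain z where "lattice_linear n x (F s) z" by auto
  then show ?case by (intro exI[of _ "F s"] exI[of _ z]) auto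
next
  case (insert s C)
  then obtain f z w where "lattice_linear n x f z" "lattice_linear n x (F s) w"
    and *: "\<And>t. (\<exists>s\<in>C. f t = F s t) \<and> (\<forall>s\<in>C. f t \<le> F s t)"
    by (metis insertCI)
  then have "lattice_linear n x (\<lambda>t. inf (f t) (F s t)) (inf z w)"
    by (intro lattice_linear_inf)
  moreover have "(\<exists>s'\<in>insert s C. inf (f t) (F s t) = F s' t)
      \<and> (\<forall>s'\<in>insert s C. inf (f t) (F s t) \<le> F s' t)" for t
    using *[of t] by (auto simp: inf_min min_def intro: order_trans)
  ultimately show ?case by blast
qed

text \<open>Tychonoff: the sphere is a closed subset of a product of compact sets, with factor
  [-1, 1] below index \<open>n\<close> and {0} from \<open>n\<close> on.\<close>

lemma compact_sphere_Euclidean_space: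
  "compact {t \<in> topspace (Euclidean_space n). (\<Sum>k<n. \<bar>t k\<bar>) = (1::real)}"
proof -
  let ?B = "\<Pi>\<^sub>E k\<in>UNIV. if k < n then {-1..1} else {0::real}"
  let ?C = "{t :: nat \<Rightarrow> real. (\<Sum>k<n. \<bar>t k\<bar>) = 1}"
  have "compactin (powertop_real UNIV) ?B"
    by (subst compactin_PiE) auto
  then have "compact ?B"
    by (simp add: euclidean_product_topology)
  moreover have "closed ?C"
    by (intro closed_Collect_eq continuous_intros
        continuous_on_product_then_coordinatewise[OF continuous_on_id])
  moreover have "{t \<in> topspace (Euclidean_space n). (\<Sum>k<n. \<bar>t k\<bar>) = 1} = ?B \<inter> ?C"
  proof -
    have "\<bar>t k\<bar> \<le> 1" if "(\<Sum>k<n. \<bar>t k\<bar>) = 1" "k < n" for t :: "nat \<Rightarrow> real" and k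
      using that member_le_sum[of k "{..<n}" "\<lambda>k. \<bar>t k\<bar>"] by simp
    then show ?thesis
      by (auto simp: topspace_Euclidean_space PiE_iff abs_le_iff minus_le_iff split: if_splits)
  qed
  ultimately show ?thesis by (simp add: compact_Int_closed)
qed

text \<open>A continuous \<open>h\<close> need not be Lipschitz at \<open>s\<close>. The slack
  \<epsilon> helps: the cone has to rise only where h t \<ge> h s + \<epsilon>, a compact set that
  misses \<open>s\<close> and so stays at positive distance from it.\<close>

lemma lipschitz_cone_above:
  assumes S: "S = {t \<in> topspace (Euclidean_space n). (\<Sum>k<n. \<bar>t k\<bar>) = (1::real)}"
    and h: "continuous_on S h" and "s \<in> S" "\<epsilon> > 0"
  obtains M where "\<And>t. t \<in> S \<Longrightarrow> h t \<le> h s + \<epsilon> + M * (\<Sum>k<n. \<bar>t k - s k\<bar>)"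
proof -
  define d where "d t = (\<Sum>k<n. \<bar>t k - s k\<bar>)" for t
  have compact: "compact S" unfolding S by (rule compact_sphere_Euclidean_space)
  let ?A = "{t\<in>S. h s + \<epsilon> \<le> h t}"
  have "?A = S \<inter> h -` {h s + \<epsilon>..}" by auto
  then have "compact ?A"
    using continuous_closedin_preimage[OF h closed_atLeast[of "h s + \<epsilon>"]] compact
    by (metis closedin_compact)
  show thesis
  proof (cases "?A = {}")
    case True
    then have "h t \<le> h s + \<epsilon> + 0 * (\<Sum>k<n. \<bar>t k - s k\<bar>)" if "t \<in> S" for t
      using that by auto
    then show thesis by (rule that)
  next
    case False
    have "continuous_on ?A d"
      unfolding d_def by (intro continuous_intros
        continuous_on_product_then_coordinatewise[OF continuous_on_id])
    then obtain t0 where t0: "t0 \<in> ?A" "\<And>t. t \<in> ?A \<Longrightarrow> d t0 \<le> d t"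
      using continuous_attains_inf[OF \<open>compact ?A\<close> False] by blast
    obtain b where b: "b \<in> S" "\<And>t. t \<in> S \<Longrightarrow> h t \<le> h b"
      using continuous_attains_sup[OF compact _ h] \<open>s \<in> S\<close> by blast
    have "d t0 \<noteq> 0"
    proof
      assume "d t0 = 0"
      then have "t0 k = s k" for k
        using t0(1) \<open>s \<in> S\<close>
        by (cases "k < n") (auto simp: d_def sum_nonneg_eq_0_iff S topspace_Euclidean_space)
      then have "t0 = s" by auto
      then show False using t0(1) \<open>\<epsilon> > 0\<close> by simp
    qed
    then have pos: "d t0 > 0" by (simp add: d_def order_less_le sum_nonneg)
    \<comment> \<open>The slope is the largest rise of \<open>h\<close> over \<open>h s\<close>
      divided by the distance from \<open>s\<close> to \<open>?A\<close>, so on \<open>?A\<close>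
      the cone has already climbed to the maximum of \<open>h\<close>.\<close>
    have "h t \<le> h s + \<epsilon> + (\<bar>h b - h s\<bar> / d t0) * (\<Sum>k<n. \<bar>t k - s k\<bar>)" if "t \<in> S" for t
    proof (cases "t \<in> ?A")
      case True
      have "h t - h s \<le> \<bar>h b - h s\<bar> * 1" using b(2)[OF that] by simp
      also have "\<dots> \<le> \<bar>h b - h s\<bar> * (d t / d t0)"
        using t0(2)[OF True] pos by (intro mult_left_mono) auto
      finally show ?thesis using \<open>\<epsilon> > 0\<close> by (simp add: d_def)
    next
      case False
      have "0 \<le> (\<bar>h b - h s\<bar> / d t0) * d t" using pos by (simp add: d_def sum_nonneg)
      moreover have "h t \<le> h s + \<epsilon>" using False that by auto
      ultimately show ?thesis unfolding d_def by linarith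
    qed
    then show thesis by (rule that)
  qed
qed

lemma krivine_function_continuous:
  "h \<in> krivine_functions n \<Longrightarrow> continuous_on (topspace (Euclidean_space n)) h"
  by (simp add: krivine_functions_def continuous_map_Euclidean_space_iff)

lemma krivine_function_homogeneous:
  "h \<in> krivine_functions n \<Longrightarrow> t \<in> topspace (Euclidean_space n) \<Longrightarrow> c \<ge> 0 \<Longrightarrow>
    h (\<lambda>j. c * t j) = c * h t"
  by (simp add: krivine_functions_def)

text \<open>A one-sided form of the lattice Stone-Weierstrass argument. Since each cone lies above
  \<open>h\<close> on the whole sphere, one finite minimum suffices, without a further maximum over
  minima. Homogeneity carries the estimate from the sphere to R^n.\<close>

lemma lattice_linear_dense:
  fixes x :: "nat \<Rightarrow> 'x::banach_lattice"
  assumes h: "h \<in> krivine_functions n" and "\<epsilon> > 0"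
  shows "\<exists>f z. lattice_linear n x f z \<and>
    (\<forall>t\<in>topspace (Euclidean_space n). \<bar>h t - f t\<bar> \<le> \<epsilon> * (\<Sum>k<n. \<bar>t k\<bar>))"
proof -
  let ?m = "\<lambda>t::nat \<Rightarrow> real. \<Sum>k<n. \<bar>t k\<bar>"
  define S where "S = {t \<in> topspace (Euclidean_space n). ?m t = 1}"
  have compact: "compact S" unfolding S_def by (rule compact_sphere_Euclidean_space)
  have cont: "continuous_on S h"
    using krivine_function_continuous[OF h] by (rule continuous_on_subset) (auto simp: S_def)
  have "\<exists>M. \<forall>t\<in>S. h t \<le> h s + \<epsilon> / 2 + M * (\<Sum>k<n. \<bar>t k - s k\<bar>)" if "s \<in> S" for s
    using lipschitz_cone_above[OF S_def cont that, of "\<epsilon> / 2"] \<open>\<epsilon> > 0\<close> by (metis half_gt_zero)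
  then obtain M where M: "\<And>s t. s \<in> S \<Longrightarrow> t \<in> S \<Longrightarrow>
      h t \<le> h s + \<epsilon> / 2 + M s * (\<Sum>k<n. \<bar>t k - s k\<bar>)"
    by metis
  \<comment> \<open>On the sphere \<open>F s\<close> is a cone with vertex near \<open>(s, h s)\<close> lying above \<open>h\<close>, so a minimum of
    finitely many \<open>F s\<close> approximates \<open>h\<close>; it is written so as to be homogeneous.\<close>
  define F where "F s t = (h s + \<epsilon> / 2) * ?m t + M s * (\<Sum>k<n. \<bar>t k - s k * ?m t\<bar>)" for s t
  have F: "\<exists>z. lattice_linear n x (F s) z" for s
    unfolding F_def
    by (rule exI[of _ "(h s + \<epsilon> / 2) *\<^sub>R (\<Sum>k<n. \<bar>x k\<bar>)
          + M s *\<^sub>R (\<Sum>k<n. \<bar>x k - s k *\<^sub>R (\<Sum>k<n. \<bar>x k\<bar>)\<bar>)"],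
        intro lattice_linear_add lattice_linear_scale lattice_linear_sum lattice_linear_abs
        lattice_linear_diff lattice_linear_coord) auto
  have above: "h t \<le> F s t" if "s \<in> S" "t \<in> S" for s t
    using M[OF that] that by (simp add: F_def S_def)
  \<comment> \<open>At t = s the cone exceeds \<open>h\<close> by only \<epsilon> / 2, so the strict
    bound by \<epsilon> survives on a neighbourhood of \<open>s\<close>.\<close>
  have "\<exists>U. open U \<and> s \<in> U \<and> (\<forall>t\<in>S \<inter> U. F s t < h t + \<epsilon>)" if "s \<in> S" for s
  proof -
    obtain z where "lattice_linear n x (F s) z" using F by blast
    then have "continuous_on S (\<lambda>t. F s t - h t)"
      by (intro continuous_on_diff cont lattice_linear_continuous)
    then obtain U where "open U" "U \<inter> S = (\<lambda>t. F s t - h t) -` {..<\<epsilon>} \<inter> S"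
      using continuous_on_open_invariant open_lessThan by metis
    moreover have "F s s - h s < \<epsilon>" using that \<open>\<epsilon> > 0\<close> by (simp add: F_def S_def)
    moreover have "\<forall>t\<in>S \<inter> U. F s t - h t < \<epsilon>" using calculation(2) by blast
    ultimately show ?thesis using that by (intro exI[of _ U]) (auto simp: diff_less_eq add.commute)
  qed
  then obtain U where U: "\<And>s. s \<in> S \<Longrightarrow> open (U s)" "\<And>s. s \<in> S \<Longrightarrow> s \<in> U s"
      "\<And>s t. s \<in> S \<Longrightarrow> t \<in> S \<Longrightarrow> t \<in> U s \<Longrightarrow> F s t < h t + \<epsilon>"
    by (metis IntI)
  obtain C where C: "C \<subseteq> S" "finite C" "S \<subseteq> (\<Union>s\<in>C. U s)"
    using compactE_image[OF compact, of S U] U by blast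
  have "\<exists>f z. lattice_linear n x f z \<and> (\<forall>t\<in>S. \<bar>h t - f t\<bar> \<le> \<epsilon>)"
  proof (cases "C = {}")
    \<comment> \<open>An empty cover means an empty sphere, that is n = 0.\<close>
    case True
    then show ?thesis using C lattice_linear_zero by blast
  next
    case False
    obtain f z where f: "lattice_linear n x f z"
        "\<And>t. (\<exists>s\<in>C. f t = F s t) \<and> (\<forall>s\<in>C. f t \<le> F s t)"
      using lattice_linear_finite_Inf[OF C(2) False, of n x F] F by blast
    have "\<bar>h t - f t\<bar> \<le> \<epsilon>" if t: "t \<in> S" for t
    proof -
      obtain s where "s \<in> C" "f t = F s t" using f(2) by blast
      then have "h t \<le> f t" using above C(1) t by auto
      moreover obtain s' where "s' \<in> C" "t \<in> U s'" using C(3) t by blast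
      then have "f t < h t + \<epsilon>" using U(3) t C(1) f(2) by (meson le_less_trans subsetD)
      ultimately show ?thesis by simp
    qed
    then show ?thesis using f(1) by blast
  qed
  then obtain f z where f: "lattice_linear n x f z" "\<And>t. t \<in> S \<Longrightarrow> \<bar>h t - f t\<bar> \<le> \<epsilon>"
    by blast
  have "\<bar>h t - f t\<bar> \<le> \<epsilon> * ?m t" if t: "t \<in> topspace (Euclidean_space n)" for t
  proof (cases "?m t = 0")
    case True
    \<comment> \<open>Here t = 0; in this form homogeneity with factor 0 shows that both functions
      vanish at \<open>t\<close>.\<close>
    then have "t = (\<lambda>j. 0 * t j)"
      using t by (auto simp: sum_nonneg_eq_0_iff topspace_Euclidean_space fun_eq_iff)
         (metis lessThan_iff not_le)
    then have "h t = 0" "f t = 0"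
      using krivine_function_homogeneous[OF h t, of 0] lattice_linear_homogeneous[OF f(1), of 0 t]
      by simp_all
    then show ?thesis using True by simp
  next
    case False
    then have pos: "?m t > 0" by (simp add: order_less_le sum_nonneg)
    define u where "u = (\<lambda>j. inverse (?m t) * t j)"
    have uE: "u \<in> topspace (Euclidean_space n)"
      using t by (simp add: u_def topspace_Euclidean_space)
    have "?m u = inverse (?m t) * ?m t"
      using pos by (simp add: u_def abs_mult sum_distrib_left)
    then have "u \<in> S" using pos uE by (simp add: S_def)
    have tu: "t = (\<lambda>j. ?m t * u j)"
      unfolding u_def by (simp only: mult.assoc[symmetric] right_inverse[OF False] mult_1_left)
    have "h t = ?m t * h u" "f t = ?m t * f u"
      using krivine_function_homogeneous[OF h uE, of "?m t"]
        lattice_linear_homogeneous[OF f(1), of "?m t" u] pos tu by simp_all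
    then have "\<bar>h t - f t\<bar> = ?m t * \<bar>h u - f u\<bar>"
      using pos by (simp add: abs_mult flip: right_diff_distrib)
    also have "\<dots> \<le> ?m t * \<epsilon>"
      using f(2)[OF \<open>u \<in> S\<close>] pos by (intro mult_left_mono) auto
    finally show ?thesis by (simp add: mult.commute)
  qed
  then show ?thesis using f(1) by blast
qed

section \<open>Existence and uniqueness of Krivine's calculus\<close>

lemma krivine_functions_add:
  "g \<in> krivine_functions n \<Longrightarrow> h \<in> krivine_functions n \<Longrightarrow> (\<lambda>t. g t + h t) \<in> krivine_functions n"
  unfolding krivine_functions_def by (auto intro: continuous_intros simp: distrib_left)

lemma krivine_functions_scale:
  "h \<in> krivine_functions n \<Longrightarrow> (\<lambda>t. c * h t) \<in> krivine_functions n"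
  unfolding krivine_functions_def by (auto intro: continuous_intros)

lemma krivine_functions_sup:
  assumes "g \<in> krivine_functions n" "h \<in> krivine_functions n"
  shows "(\<lambda>t. sup (g t) (h t)) \<in> krivine_functions n"
proof -
  have "continuous_map (Euclidean_space n) euclideanreal (\<lambda>t. sup (g t) (h t))"
    using assms[THEN krivine_function_continuous]
    unfolding continuous_map_Euclidean_space_iff sup_max by (rule continuous_on_max)
  then show ?thesis
    using assms unfolding krivine_functions_def
    by (auto simp: sup_max max_mult_distrib_left)
qed

lemma krivine_functions_lattice_linear:
  assumes "lattice_linear n x f y"
  shows "extend_zero n f \<in> krivine_functions n"
proof -
  have "continuous_on (topspace (Euclidean_space n)) (extend_zero n f)"
    using lattice_linear_continuous[OF assms]
    by (rule continuous_on_eq) (simp add: extend_zero_def)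
  moreover have "(\<lambda>j. c * t j) \<in> topspace (Euclidean_space n)"
    if "t \<in> topspace (Euclidean_space n)" for c t
    using that by (simp add: topspace_Euclidean_space)
  ultimately show ?thesis
    using lattice_linear_homogeneous[OF assms]
    by (simp add: krivine_functions_def continuous_map_Euclidean_space_iff extend_zero_def)
qed

text \<open>The closure of the graph of the calculus on lattice-linear functions.\<close>

definition krivine_limit ::
    "nat \<Rightarrow> (nat \<Rightarrow> 'x::banach_lattice) \<Rightarrow> ((nat \<Rightarrow> real) \<Rightarrow> real) \<Rightarrow> 'x \<Rightarrow> bool" where
  "krivine_limit n x h y \<longleftrightarrow> (\<forall>\<epsilon>>0. \<exists>f z. lattice_linear n x f z \<and>
    (\<forall>t\<in>topspace (Euclidean_space n). \<bar>h t - f t\<bar> \<le> \<epsilon> * (\<Sum>k<n. \<bar>t k\<bar>)) \<and> norm (y - z) \<le> \<epsilon>)"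

lemma krivine_limitE:
  assumes "krivine_limit n x h y" "\<epsilon> > 0"
  obtains f z where "lattice_linear n x f z"
    "\<And>t. t \<in> topspace (Euclidean_space n) \<Longrightarrow> \<bar>h t - f t\<bar> \<le> \<epsilon> * (\<Sum>k<n. \<bar>t k\<bar>)"
    "norm (y - z) \<le> \<epsilon>"
  using assms unfolding krivine_limit_def by meson

text \<open>Two approximants of \<open>h\<close> of accuracy \<epsilon> differ by at most 2 *
  \<epsilon> relative to the sum of the |t_k|, and so do their values in X. Hence the closure of the
  graph is again the graph of a function.\<close>

lemma krivine_limit_unique:
  assumes "krivine_limit n x h y" "krivine_limit n x h y'"
  shows "y = y'"
proof -
  let ?e = "norm (\<Sum>k<n. \<bar>x k\<bar>)"
  have bound: "norm (y - y') \<le> \<epsilon> * (2 + 2 * ?e)" if pos: "\<epsilon> > 0" for \<epsilon>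
  proof -
    obtain f z where 1: "lattice_linear n x f z"
        "\<And>t. t \<in> topspace (Euclidean_space n) \<Longrightarrow> \<bar>h t - f t\<bar> \<le> \<epsilon> * (\<Sum>k<n. \<bar>t k\<bar>)"
        "norm (y - z) \<le> \<epsilon>"
      using krivine_limitE[OF assms(1) pos] by metis
    obtain f' z' where 2: "lattice_linear n x f' z'"
        "\<And>t. t \<in> topspace (Euclidean_space n) \<Longrightarrow> \<bar>h t - f' t\<bar> \<le> \<epsilon> * (\<Sum>k<n. \<bar>t k\<bar>)"
        "norm (y' - z') \<le> \<epsilon>"
      using krivine_limitE[OF assms(2) pos] by metis
    have "norm (z - z') \<le> (2 * \<epsilon>) * ?e"
    proof (rule lattice_linear_norm_diff_le[OF 1(1) 2(1)])
      show "\<bar>f t - f' t\<bar> \<le> 2 * \<epsilon> * (\<Sum>k<n. \<bar>t k\<bar>)" if "t \<in> topspace (Euclidean_space n)" for t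
        using 1(2)[OF that] 2(2)[OF that] by linarith
    qed (use pos in simp)
    moreover have "norm (y - y') \<le> norm (y - z) + norm (z - z') + norm (y' - z')"
    proof -
      have eq: "y - y' = (y - z) + (z - z') - (y' - z')" by simp
      show ?thesis
        unfolding eq by (rule order_trans[OF norm_triangle_ineq4 add_right_mono[OF norm_triangle_ineq]])
    qed
    ultimately have "norm (y - y') \<le> \<epsilon> + 2 * \<epsilon> * ?e + \<epsilon>"
      using 1(3) 2(3) by linarith
    then show ?thesis by (simp add: algebra_simps)
  qed
  have "norm (y - y') \<le> 0"
  proof (rule field_le_epsilon)
    fix d :: real assume "d > 0"
    have "2 + 2 * ?e > 0" using norm_ge_zero[of "\<Sum>k<n. \<bar>x k\<bar>"] by linarith
    then show "norm (y - y') \<le> 0 + d"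
      using bound[of "d / (2 + 2 * ?e)"] \<open>d > 0\<close> by simp
  qed
  then show ?thesis by simp
qed

lemma krivine_limit_lattice_linear:
  assumes "lattice_linear n x f y"
    and "\<And>t. t \<in> topspace (Euclidean_space n) \<Longrightarrow> h t = f t"
  shows "krivine_limit n x h y"
  unfolding krivine_limit_def
  using assms by (intro allI impI exI[of _ f] exI[of _ y]) (simp add: sum_nonneg)

lemma krivine_limit_add:
  assumes "krivine_limit n x g y" "krivine_limit n x h z"
  shows "krivine_limit n x (\<lambda>t. g t + h t) (y + z)"
  unfolding krivine_limit_def
proof (intro allI impI)
  fix \<epsilon> :: real assume "\<epsilon> > 0"
  then have pos: "\<epsilon> / 2 > 0" by simp
  obtain f u where 1: "lattice_linear n x f u"
      "\<And>t. t \<in> topspace (Euclidean_space n) \<Longrightarrow> \<bar>g t - f t\<bar> \<le> \<epsilon> / 2 * (\<Sum>k<n. \<bar>t k\<bar>)"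
      "norm (y - u) \<le> \<epsilon> / 2"
    using krivine_limitE[OF assms(1) pos] by metis
  obtain f' u' where 2: "lattice_linear n x f' u'"
      "\<And>t. t \<in> topspace (Euclidean_space n) \<Longrightarrow> \<bar>h t - f' t\<bar> \<le> \<epsilon> / 2 * (\<Sum>k<n. \<bar>t k\<bar>)"
      "norm (z - u') \<le> \<epsilon> / 2"
    using krivine_limitE[OF assms(2) pos] by metis
  have "norm ((y + z) - (u + u')) \<le> \<epsilon>"
    using norm_diff_triangle_ineq[of y z u u'] 1(3) 2(3) by linarith
  moreover have "\<bar>(g t + h t) - (f t + f' t)\<bar> \<le> \<epsilon> * (\<Sum>k<n. \<bar>t k\<bar>)"
    if "t \<in> topspace (Euclidean_space n)" for t
    using 1(2)[OF that] 2(2)[OF that] by linarith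
  ultimately show "\<exists>f w. lattice_linear n x f w \<and>
      (\<forall>t\<in>topspace (Euclidean_space n). \<bar>(g t + h t) - f t\<bar> \<le> \<epsilon> * (\<Sum>k<n. \<bar>t k\<bar>)) \<and>
      norm (y + z - w) \<le> \<epsilon>"
    using lattice_linear_add[OF 1(1) 2(1)] by blast
qed

lemma krivine_limit_sup:
  assumes "krivine_limit n x g y" "krivine_limit n x h z"
  shows "krivine_limit n x (\<lambda>t. sup (g t) (h t)) (sup y z)"
  unfolding krivine_limit_def
proof (intro allI impI)
  fix \<epsilon> :: real assume "\<epsilon> > 0"
  then have pos: "\<epsilon> / 2 > 0" by simp
  obtain f u where 1: "lattice_linear n x f u"
      "\<And>t. t \<in> topspace (Euclidean_space n) \<Longrightarrow> \<bar>g t - f t\<bar> \<le> \<epsilon> / 2 * (\<Sum>k<n. \<bar>t k\<bar>)"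
      "norm (y - u) \<le> \<epsilon> / 2"
    using krivine_limitE[OF assms(1) pos] by metis
  obtain f' u' where 2: "lattice_linear n x f' u'"
      "\<And>t. t \<in> topspace (Euclidean_space n) \<Longrightarrow> \<bar>h t - f' t\<bar> \<le> \<epsilon> / 2 * (\<Sum>k<n. \<bar>t k\<bar>)"
      "norm (z - u') \<le> \<epsilon> / 2"
    using krivine_limitE[OF assms(2) pos] by metis
  have "norm (sup y z - sup u u') \<le> \<epsilon>"
    using norm_sup_diff_le[of y z u u'] 1(3) 2(3) by linarith
  moreover have "\<bar>sup (g t) (h t) - sup (f t) (f' t)\<bar> \<le> \<epsilon> * (\<Sum>k<n. \<bar>t k\<bar>)"
    if "t \<in> topspace (Euclidean_space n)" for t
    using 1(2)[OF that] 2(2)[OF that] abs_sup_diff_le[of "g t" "h t" "f t" "f' t"] by linarith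
  ultimately show "\<exists>f w. lattice_linear n x f w \<and>
      (\<forall>t\<in>topspace (Euclidean_space n). \<bar>sup (g t) (h t) - f t\<bar> \<le> \<epsilon> * (\<Sum>k<n. \<bar>t k\<bar>)) \<and>
      norm (sup y z - w) \<le> \<epsilon>"
    using lattice_linear.sup[OF 1(1) 2(1)] by blast
qed

lemma krivine_limit_scale:
  assumes "krivine_limit n x h y"
  shows "krivine_limit n x (\<lambda>t. c * h t) (c *\<^sub>R y)"
  unfolding krivine_limit_def
proof (intro allI impI)
  fix \<epsilon> :: real assume "\<epsilon> > 0"
  \<comment> \<open>The summand 1 covers the case c = 0.\<close>
  define d where "d = \<epsilon> / (\<bar>c\<bar> + 1)"
  have d: "d > 0" "\<bar>c\<bar> * d \<le> \<epsilon>"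
    using \<open>\<epsilon> > 0\<close> unfolding d_def by (auto simp: field_simps)
  obtain f z where 1: "lattice_linear n x f z"
      "\<And>t. t \<in> topspace (Euclidean_space n) \<Longrightarrow> \<bar>h t - f t\<bar> \<le> d * (\<Sum>k<n. \<bar>t k\<bar>)"
      "norm (y - z) \<le> d"
    using krivine_limitE[OF assms d(1)] by metis
  have "norm (c *\<^sub>R y - c *\<^sub>R z) \<le> \<epsilon>"
  proof -
    have "norm (c *\<^sub>R y - c *\<^sub>R z) = \<bar>c\<bar> * norm (y - z)"
      by (simp flip: scaleR_diff_right)
    also have "\<dots> \<le> \<bar>c\<bar> * d" using 1(3) by (rule mult_left_mono) simp
    finally show ?thesis using d(2) by simp
  qed
  moreover have "\<bar>c * h t - c * f t\<bar> \<le> \<epsilon> * (\<Sum>k<n. \<bar>t k\<bar>)"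
    if "t \<in> topspace (Euclidean_space n)" for t
  proof -
    have "\<bar>c * h t - c * f t\<bar> = \<bar>c\<bar> * \<bar>h t - f t\<bar>"
      by (simp add: abs_mult flip: right_diff_distrib)
    also have "\<dots> \<le> \<bar>c\<bar> * (d * (\<Sum>k<n. \<bar>t k\<bar>))"
      using 1(2)[OF that] by (rule mult_left_mono) simp
    also have "\<dots> \<le> \<epsilon> * (\<Sum>k<n. \<bar>t k\<bar>)"
      using d(2) mult_right_mono[of "\<bar>c\<bar> * d" \<epsilon> "\<Sum>k<n. \<bar>t k\<bar>"] by (simp add: sum_nonneg mult.assoc)
    finally show ?thesis .
  qed
  ultimately show "\<exists>f w. lattice_linear n x f w \<and>
      (\<forall>t\<in>topspace (Euclidean_space n). \<bar>c * h t - f t\<bar> \<le> \<epsilon> * (\<Sum>k<n. \<bar>t k\<bar>)) \<and>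
      norm (c *\<^sub>R y - w) \<le> \<epsilon>"
    using lattice_linear_scale[OF 1(1), of c] by blast
qed

text \<open>Approximants of accuracy 1 / (i + 1) have Cauchy values by
  \<open>lattice_linear_norm_diff_le\<close>. Here the completeness of X enters.\<close>

lemma krivine_limit_exists:
  fixes x :: "nat \<Rightarrow> 'x::banach_lattice"
  assumes "h \<in> krivine_functions n"
  shows "\<exists>y. krivine_limit n x h y"
proof -
  let ?m = "\<lambda>t::nat \<Rightarrow> real. \<Sum>k<n. \<bar>t k\<bar>" and ?e = "norm (\<Sum>k<n. \<bar>x k\<bar>)"
  have "\<exists>f z. lattice_linear n x f z \<and>
      (\<forall>t\<in>topspace (Euclidean_space n). \<bar>h t - f t\<bar> \<le> inverse (real (Suc i)) * ?m t)" for i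
    using lattice_linear_dense[OF assms, of "inverse (real (Suc i))" x] by simp
  then obtain f z where fz: "\<And>i. lattice_linear n x (f i) (z i)"
      "\<And>i t. t \<in> topspace (Euclidean_space n) \<Longrightarrow> \<bar>h t - f i t\<bar> \<le> inverse (real (Suc i)) * ?m t"
    by metis
  have dist: "norm (z i - z j) \<le> (inverse (real (Suc i)) + inverse (real (Suc j))) * ?e" for i j
  proof (rule lattice_linear_norm_diff_le[OF fz(1) fz(1)])
    show "\<bar>f i t - f j t\<bar> \<le> (inverse (real (Suc i)) + inverse (real (Suc j))) * ?m t"
      if "t \<in> topspace (Euclidean_space n)" for t
      using fz(2)[OF that, of i] fz(2)[OF that, of j] by (simp only: distrib_right)
  qed simp
  have "Cauchy z"
  proof (rule metric_CauchyI)
    fix \<epsilon> :: real assume "\<epsilon> > 0"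
    have "(\<lambda>i. inverse (real (Suc i)) * (2 * ?e)) \<longlonglongrightarrow> 0 * (2 * ?e)"
      by (intro tendsto_intros LIMSEQ_inverse_real_of_nat)
    then have "\<forall>\<^sub>F i in sequentially. inverse (real (Suc i)) * (2 * ?e) < \<epsilon>"
      using \<open>\<epsilon> > 0\<close> by (simp add: order_tendstoD)
    then obtain N where N: "inverse (real (Suc N)) * (2 * ?e) < \<epsilon>"
      by (auto simp: eventually_sequentially)
    have "dist (z i) (z j) < \<epsilon>" if "i \<ge> N" "j \<ge> N" for i j
    proof -
      have "(inverse (real (Suc i)) + inverse (real (Suc j))) * ?e
          \<le> (inverse (real (Suc N)) + inverse (real (Suc N))) * ?e"
        using that by (intro mult_right_mono add_mono le_imp_inverse_le) auto
      then show ?thesis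
        using dist[of i j] N by (simp add: dist_norm)
    qed
    then show "\<exists>M. \<forall>i\<ge>M. \<forall>j\<ge>M. dist (z i) (z j) < \<epsilon>" by blast
  qed
  then obtain y where y: "z \<longlonglongrightarrow> y" using Cauchy_convergent convergent_def by blast
  have "krivine_limit n x h y"
    unfolding krivine_limit_def
  proof (intro allI impI)
    fix \<epsilon> :: real assume "\<epsilon> > 0"
    then have "\<forall>\<^sub>F i in sequentially. dist (z i) y < \<epsilon> \<and> inverse (real (Suc i)) < \<epsilon>"
      using tendstoD[OF y] order_tendstoD(2)[OF LIMSEQ_inverse_real_of_nat]
      by (simp add: eventually_conj)
    then obtain i where i: "dist (z i) y < \<epsilon>" "inverse (real (Suc i)) < \<epsilon>"
      by (auto simp: eventually_sequentially)
    have "\<bar>h t - f i t\<bar> \<le> \<epsilon> * ?m t" if "t \<in> topspace (Euclidean_space n)" for t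
    proof -
      have "inverse (real (Suc i)) * ?m t \<le> \<epsilon> * ?m t"
        using i(2) by (intro mult_right_mono sum_nonneg) auto
      then show ?thesis using fz(2)[OF that, of i] by linarith
    qed
    moreover have "norm (y - z i) \<le> \<epsilon>" using i(1) by (simp add: dist_norm norm_minus_commute)
    ultimately show "\<exists>f z. lattice_linear n x f z \<and>
        (\<forall>t\<in>topspace (Euclidean_space n). \<bar>h t - f t\<bar> \<le> \<epsilon> * ?m t) \<and> norm (y - z) \<le> \<epsilon>"
      using fz(1)[of i] by blast
  qed
  then show ?thesis ..
qed

lemma is_krivine_calculus_exists:
  fixes x :: "nat \<Rightarrow> 'x::banach_lattice"
  shows "\<exists>\<tau>. is_krivine_calculus n x \<tau>"
proof
  \<comment> \<open>The value 0 off \<open>krivine_functions n\<close> is prescribed by the last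
    clause of \<open>is_krivine_calculus\<close>.\<close>
  let ?\<tau> = "\<lambda>h. if h \<in> krivine_functions n then THE y. krivine_limit n x h y else 0"
  have eq: "?\<tau> h = y" if "h \<in> krivine_functions n" "krivine_limit n x h y" for h y
    using that krivine_limit_unique by (auto intro!: the_equality)
  have lim: "krivine_limit n x h (?\<tau> h)" if "h \<in> krivine_functions n" for h
    using krivine_limit_exists[OF that, of x] eq[OF that] by metis
  show "is_krivine_calculus n x ?\<tau>"
    unfolding is_krivine_calculus_def
  proof (intro conjI ballI allI impI)
    fix j assume "j < n"
    then have "lattice_linear n x (\<lambda>t. t j) (x j)" by (rule lattice_linear_coord)
    then show "?\<tau> (extend_zero n (\<lambda>t. t j)) = x j"
      by (intro eq krivine_functions_lattice_linear krivine_limit_lattice_linear)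
         (auto simp: extend_zero_def)
  next
    fix h :: "(nat \<Rightarrow> real) \<Rightarrow> real" assume "h \<notin> krivine_functions n"
    then show "?\<tau> h = 0" by simp
  qed (intro eq krivine_functions_add krivine_functions_scale krivine_functions_sup
      krivine_limit_add krivine_limit_scale krivine_limit_sup lim; assumption)+
qed

section \<open>Uniqueness of the calculus\<close>

text \<open>Monotonicity is not among the axioms; it follows from preservation of suprema, as g
  \<le> h means sup g h = h.\<close>

lemma krivine_calculus_mono:
  assumes "is_krivine_calculus n x \<tau>" "g \<in> krivine_functions n" "h \<in> krivine_functions n"
    and "\<And>t. t \<in> topspace (Euclidean_space n) \<Longrightarrow> g t \<le> h t"
  shows "\<tau> g \<le> \<tau> h"
proof -
  \<comment> \<open>The equation is between functions of all sequences; off R^n both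
    \<open>g\<close> and \<open>h\<close> are 0.\<close>
  have eq: "(\<lambda>t. sup (g t) (h t)) = h"
  proof
    fix t
    show "sup (g t) (h t) = h t"
    using assms(2-4) by (cases "t \<in> topspace (Euclidean_space n)")
      (auto simp: krivine_functions_def sup_absorb2)
  qed
  have "\<tau> (\<lambda>t. sup (g t) (h t)) = sup (\<tau> g) (\<tau> h)"
    using assms(1-3) unfolding is_krivine_calculus_def by blast
  then have "\<tau> h = sup (\<tau> g) (\<tau> h)" unfolding eq .
  then show ?thesis by (rule ssubst) simp
qed

text \<open>The axioms fix the values on coordinates and commute with the operations that generate
  all lattice-linear functions.\<close>

lemma krivine_calculus_lattice_linear:
  assumes \<tau>: "is_krivine_calculus n x \<tau>" and "lattice_linear n x f y"
  shows "\<tau> (extend_zero n f) = y"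
proof -
  have add: "\<tau> (\<lambda>t. g t + h t) = \<tau> g + \<tau> h"
    and sup_hom: "\<tau> (\<lambda>t. sup (g t) (h t)) = sup (\<tau> g) (\<tau> h)"
    if "g \<in> krivine_functions n" "h \<in> krivine_functions n" for g h
    using \<tau> that unfolding is_krivine_calculus_def by blast+
  have scale: "\<tau> (\<lambda>t. c * h t) = c *\<^sub>R \<tau> h" if "h \<in> krivine_functions n" for h c
    using \<tau> that unfolding is_krivine_calculus_def by blast
  have coord: "\<tau> (extend_zero n (\<lambda>t. t j)) = x j" if "j < n" for j
    using \<tau> that unfolding is_krivine_calculus_def by blast
  show ?thesis
    using assms(2)
  proof induction
    case (meet f y)
    then show ?case
    proof induction
      case (linear a)
      \<comment> \<open>The induction is on the number \<open>m\<close> of summands while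
        \<open>n\<close> stays fixed, so that every partial sum remains a function on R^n.\<close>
      have "\<tau> (extend_zero n (\<lambda>t. \<Sum>k<m. a k * t k)) = (\<Sum>k<m. a k *\<^sub>R x k)" if "m \<le> n" for m
        using that
      proof (induction m)
        case 0
        have "extend_zero n (\<lambda>t. 0) = (\<lambda>t. 0)" by (simp add: extend_zero_def fun_eq_iff)
        moreover have "(\<lambda>t. 0) \<in> krivine_functions n"
          by (simp add: krivine_functions_def)
        ultimately show ?case using scale[of "\<lambda>t. 0" 0] by simp
      next
        case (Suc m)
        have lm: "lattice_linear n x (\<lambda>t. t m) (x m)"
          using Suc.prems by (intro lattice_linear_coord) simp
        have ls: "lattice_linear n x (\<lambda>t. \<Sum>k<m. a k * t k) (\<Sum>k<m. a k *\<^sub>R x k)"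
          using Suc.prems by (intro lattice_linear_sum lattice_linear_scale lattice_linear_coord) auto
        have "\<tau> (extend_zero n (\<lambda>t. \<Sum>k<Suc m. a k * t k)) =
            \<tau> (\<lambda>t. extend_zero n (\<lambda>t. \<Sum>k<m. a k * t k) t + a m * extend_zero n (\<lambda>t. t m) t)"
          by (rule arg_cong[of _ _ \<tau>]) (simp add: extend_zero_def fun_eq_iff)
        also have "\<dots> = (\<Sum>k<m. a k *\<^sub>R x k) + a m *\<^sub>R x m"
          using Suc lm ls
          by (simp add: add scale coord krivine_functions_lattice_linear krivine_functions_scale)
        finally show ?case by simp
      qed
      then show ?case by simp
    next
      case (inf f y g z)
      let ?f = "extend_zero n f" and ?g = "extend_zero n g"
      have H: "?f \<in> krivine_functions n" "?g \<in> krivine_functions n"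
        using inf.hyps lattice_linear.meet krivine_functions_lattice_linear by blast+
      \<comment> \<open>The axioms speak of suprema, so the infimum is expressed through them and
        multiplication by -1.\<close>
      have "inf (f t) (g t) = - sup (- f t) (- g t)" for t by (rule inf_eq_neg_sup)
      then have "\<tau> (extend_zero n (\<lambda>t. inf (f t) (g t))) = \<tau> (\<lambda>t. -1 * sup (-1 * ?f t) (-1 * ?g t))"
        by (intro arg_cong[of _ _ \<tau>]) (auto simp: extend_zero_def fun_eq_iff simp del: neg_sup_eq_inf)
      also have "\<dots> = -1 *\<^sub>R sup (-1 *\<^sub>R y) (-1 *\<^sub>R z)"
        using H inf.IH by (simp only: scale sup_hom krivine_functions_scale krivine_functions_sup)
      also have "\<dots> = inf y z" by simp
      finally show ?case .
    qed
  next
    case (sup f y g z)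
    let ?f = "extend_zero n f" and ?g = "extend_zero n g"
    have H: "?f \<in> krivine_functions n" "?g \<in> krivine_functions n"
      using sup.hyps krivine_functions_lattice_linear by blast+
    have "extend_zero n (\<lambda>t. sup (f t) (g t)) = (\<lambda>t. sup (?f t) (?g t))"
      by (simp add: extend_zero_def fun_eq_iff)
    then show ?case using H sup.IH by (simp only: sup_hom)
  qed
qed

text \<open>No continuity of \<open>\<tau>\<close> is assumed. It comes from monotonicity:
  \<open>h\<close> is squeezed between two lattice-linear functions f - d * m and f + d * m, with m
  the sum of the |t_k|, whose values under \<open>\<tau>\<close> are already known.\<close>

lemma krivine_calculus_limit:
  assumes \<tau>: "is_krivine_calculus n x \<tau>" and h: "h \<in> krivine_functions n"
  shows "krivine_limit n x h (\<tau> h)"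
  unfolding krivine_limit_def
proof (intro allI impI)
  fix \<epsilon> :: real assume "\<epsilon> > 0"
  let ?m = "\<lambda>t::nat \<Rightarrow> real. \<Sum>k<n. \<bar>t k\<bar>" and ?e = "\<Sum>k<n. \<bar>x k\<bar>"
  \<comment> \<open>Small enough for both errors: d \<le> \<epsilon> for functions, d * norm ?e
    \<le> \<epsilon> for values.\<close>
  define d where "d = \<epsilon> / (1 + norm ?e)"
  have pos: "1 + norm ?e > 0" using norm_ge_zero[of ?e] by linarith
  then have d: "d > 0" "d \<le> \<epsilon>" "d * norm ?e \<le> \<epsilon>"
    using \<open>\<epsilon> > 0\<close> by (auto simp: d_def field_simps)
  obtain f z where f: "lattice_linear n x f z"
      "\<And>t. t \<in> topspace (Euclidean_space n) \<Longrightarrow> \<bar>h t - f t\<bar> \<le> d * ?m t"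
    using lattice_linear_dense[OF h d(1), of x] by blast
  have m: "lattice_linear n x ?m ?e"
    by (intro lattice_linear_sum lattice_linear_abs lattice_linear_coord) simp
  have up: "lattice_linear n x (\<lambda>t. f t + d * ?m t) (z + d *\<^sub>R ?e)"
    using f(1) m by (intro lattice_linear_add lattice_linear_scale)
  have lo: "lattice_linear n x (\<lambda>t. f t - d * ?m t) (z - d *\<^sub>R ?e)"
    using f(1) m by (intro lattice_linear_diff lattice_linear_scale)
  have "\<tau> h \<le> \<tau> (extend_zero n (\<lambda>t. f t + d * ?m t))"
    using f(2) by (intro krivine_calculus_mono[OF \<tau> h] krivine_functions_lattice_linear[OF up])
      (auto simp: extend_zero_def abs_le_iff diff_le_eq add.commute)
  moreover have "\<tau> (extend_zero n (\<lambda>t. f t - d * ?m t)) \<le> \<tau> h"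
    using f(2) by (intro krivine_calculus_mono[OF \<tau> _ h] krivine_functions_lattice_linear[OF lo])
      (auto simp: extend_zero_def abs_le_iff diff_le_eq add.commute)
  ultimately have "\<bar>\<tau> h - z\<bar> \<le> d *\<^sub>R ?e"
    unfolding krivine_calculus_lattice_linear[OF \<tau> up] krivine_calculus_lattice_linear[OF \<tau> lo]
    by (intro abs_leI) (simp_all add: algebra_simps)
  then have "norm \<bar>\<tau> h - z\<bar> \<le> norm (d *\<^sub>R ?e)"
    by (intro norm_mono_nonneg) auto
  then have "norm (\<tau> h - z) \<le> \<epsilon>" using d by simp
  moreover have "\<bar>h t - f t\<bar> \<le> \<epsilon> * ?m t" if "t \<in> topspace (Euclidean_space n)" for t
  proof -
    have "d * ?m t \<le> \<epsilon> * ?m t" using d(2) by (intro mult_right_mono sum_nonneg) auto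
    then show ?thesis using f(2)[OF that] by linarith
  qed
  ultimately show "\<exists>f z. lattice_linear n x f z \<and>
      (\<forall>t\<in>topspace (Euclidean_space n). \<bar>h t - f t\<bar> \<le> \<epsilon> * ?m t) \<and> norm (\<tau> h - z) \<le> \<epsilon>"
    using f(1) by blast
qed

theorem krivine_calculus_unique:
  assumes "is_krivine_calculus n x \<tau>" "is_krivine_calculus n x \<tau>'"
  shows "\<tau> = \<tau>'"
proof
  fix h
  show "\<tau> h = \<tau>' h"
  proof (cases "h \<in> krivine_functions n")
    case True
    then show ?thesis using assms[THEN krivine_calculus_limit] krivine_limit_unique by blast
  next
    case False
    then show ?thesis using assms by (simp add: is_krivine_calculus_def)
  qed
qed

theorem is_krivine_calculus_krivine: "is_krivine_calculus n x (krivine n x)"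
  unfolding krivine_def
  by (rule theI'[where P = "is_krivine_calculus n x"])
    (use is_krivine_calculus_exists krivine_calculus_unique in blast)

lemma krivine_eqI: "is_krivine_calculus n x \<tau> \<Longrightarrow> krivine n x = \<tau>"
  using is_krivine_calculus_krivine krivine_calculus_unique by blast

section \<open>Substitution in Krivine's calculus\<close>

lemma topspace_Euclidean_space_truncate: "(\<lambda>j. if j < n then f j else 0) \<in> topspace (Euclidean_space n)"
  by (simp add: topspace_Euclidean_space)

lemma krivine_functions_compose:
  assumes L: "\<And>j. j < n \<Longrightarrow> L j \<in> krivine_functions m" and h: "h \<in> krivine_functions n"
  shows "extend_zero m (\<lambda>t. h (\<lambda>j. if j < n then L j t else 0)) \<in> krivine_functions m"
proof -
  let ?h = "\<lambda>t. h (\<lambda>j. if j < n then L j t else 0)"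
  have "continuous_map (Euclidean_space m) (Euclidean_space n) (\<lambda>t j. if j < n then L j t else 0)"
    using L by (subst continuous_map_componentwise_Euclidean_space) (auto simp: krivine_functions_def)
  moreover have "continuous_map (Euclidean_space n) euclideanreal h"
    using h by (simp add: krivine_functions_def)
  ultimately have "continuous_map (Euclidean_space m) euclideanreal ?h"
    using continuous_map_compose by (fastforce simp: o_def)
  then have "continuous_map (Euclidean_space m) euclideanreal (extend_zero m ?h)"
    by (rule continuous_map_eq) (simp add: extend_zero_def)
  moreover have "extend_zero m ?h (\<lambda>j. c * t j) = c * extend_zero m ?h t"
    if t: "t \<in> topspace (Euclidean_space m)" and "c \<ge> 0" for t c
  proof -
    have "(\<lambda>j. c * t j) \<in> topspace (Euclidean_space m)"
      using t by (simp add: topspace_Euclidean_space)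
    moreover have "(\<lambda>j. if j < n then L j (\<lambda>j. c * t j) else 0) = (\<lambda>j. c * (if j < n then L j t else 0))"
      using krivine_function_homogeneous[OF L t \<open>c \<ge> 0\<close>] by auto
    ultimately show ?thesis
      using t krivine_function_homogeneous[OF h topspace_Euclidean_space_truncate \<open>c \<ge> 0\<close>]
      by (simp add: extend_zero_def)
  qed
  ultimately show ?thesis
    by (simp add: krivine_functions_def) (simp add: extend_zero_def)
qed

text \<open>Composition with the \<open>L j\<close> followed by the calculus of \<open>x\<close>
  satisfies the axioms of the calculus for the tuple of values \<open>krivine m x (L j)\<close>;
  uniqueness identifies the two.\<close>

lemma krivine_compose:
  assumes L: "\<And>j. j < n \<Longrightarrow> L j \<in> krivine_functions m" and h: "h \<in> krivine_functions n"
  shows "krivine n (\<lambda>j. krivine m x (L j)) h =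
    krivine m x (extend_zero m (\<lambda>t. h (\<lambda>j. if j < n then L j t else 0)))"
proof -
  define C where "C h = extend_zero m (\<lambda>t. h (\<lambda>j. if j < n then L j t else 0))" for h
  define \<tau> where "\<tau> h = (if h \<in> krivine_functions n then krivine m x (C h) else 0)" for h
  have C: "C h \<in> krivine_functions m" if "h \<in> krivine_functions n" for h
    unfolding C_def using L that by (rule krivine_functions_compose)
  note K = is_krivine_calculus_krivine[of m x, unfolded is_krivine_calculus_def]
  have "is_krivine_calculus n (\<lambda>j. krivine m x (L j)) \<tau>"
    unfolding is_krivine_calculus_def
  proof (intro conjI ballI allI impI)
    fix g h :: "(nat \<Rightarrow> real) \<Rightarrow> real"
    assume gh: "g \<in> krivine_functions n" "h \<in> krivine_functions n"
    have "C (\<lambda>t. g t + h t) = (\<lambda>t. C g t + C h t)" "C (\<lambda>t. sup (g t) (h t)) = (\<lambda>t. sup (C g t) (C h t))"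
      by (auto simp: C_def extend_zero_def)
    moreover have "krivine m x (\<lambda>t. C g t + C h t) = krivine m x (C g) + krivine m x (C h)"
        "krivine m x (\<lambda>t. sup (C g t) (C h t)) = sup (krivine m x (C g)) (krivine m x (C h))"
      using K C[OF gh(1)] C[OF gh(2)] by blast+
    ultimately show "\<tau> (\<lambda>t. g t + h t) = \<tau> g + \<tau> h" "\<tau> (\<lambda>t. sup (g t) (h t)) = sup (\<tau> g) (\<tau> h)"
      using gh krivine_functions_add[OF gh] krivine_functions_sup[OF gh] by (simp_all add: \<tau>_def)
  next
    fix h :: "(nat \<Rightarrow> real) \<Rightarrow> real" and c
    assume h: "h \<in> krivine_functions n"
    have "C (\<lambda>t. c * h t) = (\<lambda>t. c * C h t)"
      by (auto simp: C_def extend_zero_def)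
    moreover have "krivine m x (\<lambda>t. c * C h t) = c *\<^sub>R krivine m x (C h)"
      using K C[OF h] by blast
    ultimately show "\<tau> (\<lambda>t. c * h t) = c *\<^sub>R \<tau> h"
      using h krivine_functions_scale[OF h] by (simp add: \<tau>_def)
  next
    fix j assume j: "j < n"
    \<comment> \<open>This holds off R^m as well, because \<open>L j\<close> vanishes there.\<close>
    have "C (extend_zero n (\<lambda>t. t j)) = L j"
    proof
      fix t
      show "C (extend_zero n (\<lambda>t. t j)) t = L j t"
        using L[OF j] j topspace_Euclidean_space_truncate[of n "\<lambda>j. L j t"]
        by (auto simp: C_def extend_zero_def krivine_functions_def)
    qed
    moreover have "extend_zero n (\<lambda>t. t j) \<in> krivine_functions n"
      using krivine_functions_lattice_linear[OF lattice_linear_coord[OF j, of x]] .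
    ultimately show "\<tau> (extend_zero n (\<lambda>t. t j)) = krivine m x (L j)"
      by (simp add: \<tau>_def)
  qed (simp add: \<tau>_def)
  then show ?thesis
    using h by (simp add: krivine_eqI \<tau>_def C_def)
qed

lemma krivine_cong:
  assumes "\<And>j. j < n \<Longrightarrow> x j = y j"
  shows "krivine n x = krivine n y"
proof -
  have "is_krivine_calculus n x = is_krivine_calculus n y"
    using assms by (simp add: is_krivine_calculus_def fun_eq_iff)
  then show ?thesis by (simp add: krivine_def)
qed

text \<open>Several tuples built from one \<open>x\<close> are hereby evaluated in the calculus of
  \<open>x\<close>, where their norms can be compared pointwise on R^m. The second claim supplies
  the membership that \<open>krivine_mono\<close> asks for.\<close>

lemma krivine_substitute:
  assumes F: "\<forall>j<n. lattice_linear m x (F j) (y j)" and h: "h \<in> krivine_functions n"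
  shows "krivine n y h = krivine m x (extend_zero m (\<lambda>t. h (\<lambda>j. if j < n then F j t else 0)))"
    and "extend_zero m (\<lambda>t. h (\<lambda>j. if j < n then F j t else 0)) \<in> krivine_functions m"
proof -
  have L: "extend_zero m (F j) \<in> krivine_functions m" if "j < n" for j
    using F that krivine_functions_lattice_linear by blast
  have eq: "extend_zero m (\<lambda>t. h (\<lambda>j. if j < n then extend_zero m (F j) t else 0)) =
      extend_zero m (\<lambda>t. h (\<lambda>j. if j < n then F j t else 0))"
    by (rule ext) (simp add: extend_zero_def cong: if_cong)
  have "krivine n y h = krivine n (\<lambda>j. krivine m x (extend_zero m (F j))) h"
  proof -
    have "y j = krivine m x (extend_zero m (F j))" if "j < n" for j
      using F that krivine_calculus_lattice_linear[OF is_krivine_calculus_krivine] by (metis (no_types))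
    then show ?thesis using krivine_cong[of n y] by simp
  qed
  then show "krivine n y h = krivine m x (extend_zero m (\<lambda>t. h (\<lambda>j. if j < n then F j t else 0)))"
    using krivine_compose[of n "\<lambda>j. extend_zero m (F j)" m h x] L h unfolding eq by simp
  show "extend_zero m (\<lambda>t. h (\<lambda>j. if j < n then F j t else 0)) \<in> krivine_functions m"
    using krivine_functions_compose[of n "\<lambda>j. extend_zero m (F j)" m h] L h unfolding eq by simp
qed

lemmas krivine_mono = krivine_calculus_mono[OF is_krivine_calculus_krivine]

lemma krivine_nonneg:
  assumes h: "h \<in> krivine_functions n"
    and "\<And>t. t \<in> topspace (Euclidean_space n) \<Longrightarrow> 0 \<le> h t"
  shows "0 \<le> krivine n x h"
proof -
  have z: "lattice_linear n x (\<lambda>t. 0) 0" by (rule lattice_linear_zero)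
  have "krivine n x (extend_zero n (\<lambda>t. 0)) \<le> krivine n x h"
    using assms(2) by (intro krivine_mono krivine_functions_lattice_linear[OF z] h) (simp add: extend_zero_def)
  then show ?thesis
    by (simp add: krivine_calculus_lattice_linear[OF is_krivine_calculus_krivine z])
qed

lemma krivine_add:
  "g \<in> krivine_functions n \<Longrightarrow> h \<in> krivine_functions n \<Longrightarrow>
    krivine n x (\<lambda>t. g t + h t) = krivine n x g + krivine n x h"
  using is_krivine_calculus_krivine[of n x] unfolding is_krivine_calculus_def by blast

section \<open>Norms of tuples and sequences\<close>

context banach_sequence_lattice
begin

lemma norm_zero: "normY (\<lambda>j. 0) = 0"
  using norm_eq_zero[OF zero_mem] by simp

lemma norm_nonneg: "f \<in> Y \<Longrightarrow> 0 \<le> normY f"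
  using solid_norm[of f "\<lambda>j. 0"] by (simp add: norm_zero)

lemma diff_mem: "f \<in> Y \<Longrightarrow> g \<in> Y \<Longrightarrow> (\<lambda>j. f j - g j) \<in> Y"
  using add_mem[of f "\<lambda>j. (-1) * g j"] scale_mem[of g "-1"] by simp

lemma norm_diff_le: "f \<in> Y \<Longrightarrow> g \<in> Y \<Longrightarrow> normY (\<lambda>j. f j - g j) \<le> normY f + normY g"
  using norm_triangle[of f "\<lambda>j. (-1) * g j"] scale_mem[of g "-1"] norm_scale[of g "-1"] by simp

lemma norm_minus_commute: "f \<in> Y \<Longrightarrow> g \<in> Y \<Longrightarrow> normY (\<lambda>j. f j - g j) = normY (\<lambda>j. g j - f j)"
  using norm_scale[OF diff_mem, of g f "-1"] by simp

lemma norm_le_diff_add: "f \<in> Y \<Longrightarrow> g \<in> Y \<Longrightarrow> normY f \<le> normY (\<lambda>j. f j - g j) + normY g"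
  using norm_triangle[OF diff_mem, of f g g] by simp

lemma abs_norm_diff_le:
  assumes "f \<in> Y" "g \<in> Y"
  shows "\<bar>normY f - normY g\<bar> \<le> normY (\<lambda>j. f j - g j)"
  using norm_le_diff_add[OF assms] norm_le_diff_add[OF assms(2,1)] norm_minus_commute[OF assms]
  by linarith

text \<open>Splitting off the last coordinate reduces to unit sequences. The explicit bound, applied
  to t - s, later gives continuity of \<open>normY\<close> on R^n for coordinatewise
  convergence.\<close>

lemma finite_support_mem_norm_le:
  assumes "\<And>i. i \<ge> n \<Longrightarrow> t i = 0"
  shows "t \<in> Y \<and> normY t \<le> (\<Sum>k<n. \<bar>t k\<bar> * normY (\<lambda>j. if j = k then 1 else 0))"
  using assms
proof (induction n arbitrary: t)
  case 0
  then have "t = (\<lambda>j. 0)" by auto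
  then show ?case by (simp add: zero_mem norm_zero)
next
  case (Suc n)
  let ?e = "\<lambda>j. if j = n then 1 else (0::real)"
  let ?s = "\<lambda>j. if j = n then 0 else t j"
  have s: "?s \<in> Y \<and> normY ?s \<le> (\<Sum>k<n. \<bar>?s k\<bar> * normY (\<lambda>j. if j = k then 1 else 0))"
    using Suc.prems by (intro Suc.IH) auto
  have e: "(\<lambda>j. t n * ?e j) \<in> Y" "normY (\<lambda>j. t n * ?e j) = \<bar>t n\<bar> * normY ?e"
    using scale_mem norm_scale unit_mem by blast+
  have t: "t = (\<lambda>j. ?s j + t n * ?e j)" by auto
  have "t \<in> Y" by (subst t) (intro add_mem e(1), use s in simp)
  moreover have "normY t \<le> normY ?s + normY (\<lambda>j. t n * ?e j)"
    by (subst t) (intro norm_triangle e(1), use s in simp)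
  moreover have "(\<Sum>k<n. \<bar>?s k\<bar> * normY (\<lambda>j. if j = k then 1 else 0)) =
      (\<Sum>k<n. \<bar>t k\<bar> * normY (\<lambda>j. if j = k then 1 else 0))"
    by (intro sum.cong) auto
  ultimately show ?case using s e(2) by simp
qed

lemma Euclidean_space_subset: "t \<in> topspace (Euclidean_space n) \<Longrightarrow> t \<in> Y"
  using finite_support_mem_norm_le[of n t] by (simp add: topspace_Euclidean_space)

lemma krivine_functions_norm: "extend_zero n normY \<in> krivine_functions n"
proof -
  let ?E = "topspace (Euclidean_space n)"
  have "continuous_on ?E normY"
    unfolding continuous_on_def
  proof
    fix s assume s: "s \<in> ?E"
    let ?b = "\<lambda>t. \<Sum>k<n. \<bar>t k - s k\<bar> * normY (\<lambda>j. if j = k then 1 else 0)"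
    have "continuous_on ?E ?b"
      by (intro continuous_intros continuous_on_product_then_coordinatewise[OF continuous_on_id])
    then have "(?b \<longlongrightarrow> ?b s) (at s within ?E)"
      using s unfolding continuous_on_def by blast
    then have lim: "(?b \<longlongrightarrow> 0) (at s within ?E)" by simp
    have bound: "norm (normY t - normY s) \<le> ?b t" if "t \<in> ?E" for t
    proof -
      have "normY (\<lambda>j. t j - s j) \<le> ?b t"
        using that s finite_support_mem_norm_le[of n "\<lambda>j. t j - s j"]
        by (simp add: topspace_Euclidean_space)
      then show ?thesis
        using abs_norm_diff_le[OF Euclidean_space_subset[OF that] Euclidean_space_subset[OF s]] by simp
    qed
    have "\<forall>\<^sub>F t in at s within ?E. t \<in> ?E"
      by (simp add: eventually_at_filter)
    then have "\<forall>\<^sub>F t in at s within ?E. norm (normY t - normY s) \<le> ?b t"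
      by (rule eventually_mono) (rule bound)
    then have "((\<lambda>t. normY t - normY s) \<longlongrightarrow> 0) (at s within ?E)"
      using lim by (rule Lim_null_comparison)
    then show "(normY \<longlongrightarrow> normY s) (at s within ?E)" by (simp add: LIM_zero_cancel)
  qed
  then have "continuous_on ?E (extend_zero n normY)"
    by (rule continuous_on_eq) (simp add: extend_zero_def)
  moreover have "(\<lambda>j. c * t j) \<in> ?E" if "t \<in> ?E" for c t
    using that by (simp add: topspace_Euclidean_space)
  ultimately show ?thesis
    by (simp add: krivine_functions_def continuous_map_Euclidean_space_iff extend_zero_def
        norm_scale Euclidean_space_subset)
qed

lemma krivine_norm_nonneg: "0 \<le> krivine n x (extend_zero n normY)"
  by (rule krivine_nonneg[OF krivine_functions_norm])
     (simp add: extend_zero_def norm_nonneg Euclidean_space_subset)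

text \<open>The shorter tuple is read as the first \<open>m\<close> of \<open>n\<close> coordinates;
  then the claim is that truncation decreases \<open>normY\<close>, which is solidity.\<close>

lemma tau_norm_mono:
  assumes "m \<le> n"
  shows "tau_norm normY m x \<le> tau_norm normY n x"
proof -
  have F: "\<forall>j<m. lattice_linear n x (\<lambda>t. t j) (x j)"
    using assms by (auto intro: lattice_linear_coord)
  note S = krivine_substitute[of m n x, OF F krivine_functions_norm]
  have "krivine m x (extend_zero m normY) \<le> krivine n x (extend_zero n normY)"
    unfolding S(1)
  proof (rule krivine_mono[OF S(2) krivine_functions_norm])
    fix t assume t: "t \<in> topspace (Euclidean_space n)"
    have "normY (\<lambda>j. if j < m then t j else 0) \<le> normY t"
      using Euclidean_space_subset[OF t] by (rule solid_norm) simp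
    then show "extend_zero n (\<lambda>t. extend_zero m normY (\<lambda>j. if j < m then t j else 0)) t
        \<le> extend_zero n normY t"
      using t by (simp add: extend_zero_def topspace_Euclidean_space_truncate)
  qed
  then show ?thesis
    unfolding tau_norm_def by (rule norm_mono_nonneg[OF krivine_norm_nonneg])
qed

text \<open>The substitution goes the other way: in \<open>m\<close> variables, the appended entries
  are the expression 0, and R^m sits inside R^n with the same \<open>normY\<close>.\<close>

lemma tau_norm_eventually_zero:
  assumes "m \<le> n" "\<And>j. j \<ge> m \<Longrightarrow> x j = 0"
  shows "tau_norm normY n x = tau_norm normY m x"
proof -
  have F: "\<forall>j<n. lattice_linear m x (if j < m then \<lambda>t. t j else (\<lambda>t. 0)) (x j)"
    using assms(2) by (auto intro: lattice_linear_coord lattice_linear_zero)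
  have "extend_zero m (\<lambda>t. extend_zero n normY
        (\<lambda>j. if j < n then (if j < m then \<lambda>t. t j else (\<lambda>t. 0)) t else 0)) t = extend_zero m normY t" for t
  proof (cases "t \<in> topspace (Euclidean_space m)")
    case True
    then have "(\<lambda>j. if j < n then (if j < m then \<lambda>t. t j else (\<lambda>t. 0)) t else 0) = t"
      using assms(1) by (auto simp: topspace_Euclidean_space fun_eq_iff)
    moreover have "t \<in> topspace (Euclidean_space n)"
      using True assms(1) subset_Euclidean_space by blast
    ultimately show ?thesis using True by (simp add: extend_zero_def)
  qed (simp add: extend_zero_def)
  then have "extend_zero m (\<lambda>t. extend_zero n normY
        (\<lambda>j. if j < n then (if j < m then \<lambda>t. t j else (\<lambda>t. 0)) t else 0)) = extend_zero m normY" ..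
  then show ?thesis
    using krivine_substitute(1)[of n m x, OF F krivine_functions_norm] by (simp add: tau_norm_def)
qed

text \<open>The triangle inequality of \<open>normY\<close> transfers once both tuples live in one
  calculus: \<open>?z\<close> concatenates them, and \<open>x\<close>, \<open>y\<close> and their
  difference become three substitutions in 2n variables.\<close>

lemma tau_norm_diff_le:
  "tau_norm normY n (\<lambda>j. x j - y j) \<le> tau_norm normY n x + tau_norm normY n y"
proof -
  let ?m = "n + n" and ?z = "\<lambda>j. if j < n then x j else y (j - n)"
  have X: "\<forall>j<n. lattice_linear ?m ?z (\<lambda>t. t j) (x j)"
  proof (intro allI impI)
    fix j assume "j < n"
    then show "lattice_linear ?m ?z (\<lambda>t. t j) (x j)"
      using lattice_linear_coord[of j ?m ?z] by simp
  qed
  have Y: "\<forall>j<n. lattice_linear ?m ?z (\<lambda>t. t (n + j)) (y j)"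
  proof (intro allI impI)
    fix j assume "j < n"
    then show "lattice_linear ?m ?z (\<lambda>t. t (n + j)) (y j)"
      using lattice_linear_coord[of "n + j" ?m ?z] by simp
  qed
  have D: "\<forall>j<n. lattice_linear ?m ?z (\<lambda>t. t j - t (n + j)) (x j - y j)"
    using X Y lattice_linear_diff by blast
  note SX = krivine_substitute[of n ?m ?z, OF X krivine_functions_norm]
    and SY = krivine_substitute[of n ?m ?z, OF Y krivine_functions_norm]
    and SD = krivine_substitute[of n ?m ?z, OF D krivine_functions_norm]
  let ?G = "extend_zero n normY"
  have "krivine n (\<lambda>j. x j - y j) ?G \<le> krivine n x ?G + krivine n y ?G"
    unfolding SX(1) SY(1) SD(1) krivine_add[OF SX(2) SY(2), symmetric]
  proof (rule krivine_mono[OF SD(2) krivine_functions_add[OF SX(2) SY(2)]])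
    fix t :: "nat \<Rightarrow> real"
    have "normY (\<lambda>j. (if j < n then t j else 0) - (if j < n then t (n + j) else 0)) \<le>
        normY (\<lambda>j. if j < n then t j else 0) + normY (\<lambda>j. if j < n then t (n + j) else 0)"
      by (intro norm_diff_le Euclidean_space_subset[OF topspace_Euclidean_space_truncate])
    moreover have "(\<lambda>j. (if j < n then t j else 0) - (if j < n then t (n + j) else 0)) =
        (\<lambda>j. if j < n then t j - t (n + j) else 0)" by auto
    ultimately show "extend_zero ?m (\<lambda>t. ?G (\<lambda>j. if j < n then t j - t (n + j) else 0)) t
        \<le> extend_zero ?m (\<lambda>t. ?G (\<lambda>j. if j < n then t j else 0)) t
          + extend_zero ?m (\<lambda>t. ?G (\<lambda>j. if j < n then t (n + j) else 0)) t"
      by (simp add: extend_zero_def topspace_Euclidean_space_truncate)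
  qed
  then have "norm (krivine n (\<lambda>j. x j - y j) ?G) \<le> norm (krivine n x ?G + krivine n y ?G)"
    by (rule norm_mono_nonneg[OF krivine_norm_nonneg])
  then show ?thesis
    unfolding tau_norm_def using norm_triangle_ineq order_trans by blast
qed

end

lemma LIMSEQ_norm_diff_le:
  fixes a :: "nat \<Rightarrow> 'a::real_normed_vector"
  assumes "\<And>k. norm (a k - l) \<le> b k" "b \<longlonglongrightarrow> 0"
  shows "a \<longlonglongrightarrow> l"
  by (rule LIM_zero_cancel, rule Lim_null_comparison[OF always_eventually assms(2)])
     (use assms(1) in blast)

section \<open>The sequence spaces over E and X\<close>

context banach_sequence_lattice
begin

lemma unit_norm_pos: "0 < normY (\<lambda>j. if j = i then 1 else 0)"
proof -
  have "(\<lambda>j. if j = i then 1 else 0) \<noteq> (\<lambda>j. 0::real)" by (metis zero_neq_one)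
  then show ?thesis
    using norm_nonneg[OF unit_mem[of i]] norm_eq_zero[OF unit_mem[of i]] by linarith
qed

text \<open>Solidity applied to the i-th coordinate part of \<open>f\<close>. It makes coordinates
  continuous on \<open>Y\<close>, so that limits in \<open>Y\<close> can be identified entry by
  entry.\<close>

lemma coordinate_le_norm:
  assumes "f \<in> Y"
  shows "\<bar>f i\<bar> * normY (\<lambda>j. if j = i then 1 else 0) \<le> normY f"
proof -
  have "normY (\<lambda>j. f i * (if j = i then 1 else 0)) \<le> normY f"
    using assms by (rule solid_norm) auto
  then show ?thesis using norm_scale[OF unit_mem] by simp
qed

lemma ell_norm_nonneg: "w \<in> ell Y \<Longrightarrow> 0 \<le> ell_norm normY w"
  by (simp add: ell_def ell_norm_def norm_nonneg)

lemma ell_eventually_zero: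
  assumes "\<And>j. j \<ge> n \<Longrightarrow> w j = 0"
  shows "w \<in> ell Y" "ell_norm normY w = tuple_norm normY n w"
proof -
  show "w \<in> ell Y"
    using assms finite_support_mem_norm_le[of n "\<lambda>j. norm (w j)"] by (simp add: ell_def)
  have "(\<lambda>j. norm (w j)) = (\<lambda>j. if j < n then norm (w j) else 0)"
    using assms by (auto simp: not_less)
  then show "ell_norm normY w = tuple_norm normY n w" by (simp add: ell_norm_def tuple_norm_def)
qed

lemma ell_diff:
  assumes "v \<in> ell Y" "w \<in> ell Y"
  shows "(\<lambda>j. v j - w j) \<in> ell Y"
  using solid_mem[OF add_mem[of "\<lambda>j. norm (v j)" "\<lambda>j. norm (w j)"], of "\<lambda>j. norm (v j - w j)"] assms
  by (simp add: ell_def norm_triangle_ineq4)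

lemma tuple_norm_le_ell_norm: "w \<in> ell Y \<Longrightarrow> tuple_norm normY n w \<le> ell_norm normY w"
  unfolding ell_def ell_norm_def tuple_norm_def by (auto intro: solid_norm)

text \<open>Appended zeros do not change the tau-norm, so n = 0 suffices; R^0 consists of the zero
  sequence only, where \<open>normY\<close> agrees with the function 0.\<close>

lemma tau_norm_zero: "tau_norm normY n (\<lambda>j. 0 :: 'x::banach_lattice) = 0"
proof -
  have z: "lattice_linear 0 (\<lambda>j. 0 :: 'x) (\<lambda>t. 0) 0" by (rule lattice_linear_zero)
  have "extend_zero 0 normY t = extend_zero 0 (\<lambda>t. 0) t" for t
  proof (cases "t \<in> topspace (Euclidean_space 0)")
    case True
    then have "t = (\<lambda>j. 0)" by (auto simp: topspace_Euclidean_space)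
    then show ?thesis by (simp add: extend_zero_def norm_zero)
  qed (simp add: extend_zero_def)
  then have "extend_zero 0 normY = extend_zero 0 (\<lambda>t. 0)" ..
  then have "tau_norm normY 0 (\<lambda>j. 0 :: 'x) = 0"
    by (simp add: tau_norm_def krivine_calculus_lattice_linear[OF is_krivine_calculus_krivine z])
  then show ?thesis using tau_norm_eventually_zero[of 0 n "\<lambda>j. 0 :: 'x"] by simp
qed

lemma tau_norm_nonneg: "0 \<le> tau_norm normY n x"
  by (simp add: tau_norm_def)

lemma tau_norm_cong: "(\<And>j. j < n \<Longrightarrow> x j = y j) \<Longrightarrow> tau_norm normY n x = tau_norm normY n y"
  using krivine_cong[of n x y] by (simp add: tau_norm_def)

lemma tau_norm_le_ell_tau_norm: "x \<in> ell_tau normY \<Longrightarrow> tau_norm normY n x \<le> ell_tau_norm normY x"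
  unfolding ell_tau_def ell_tau_norm_def by (auto intro: cSUP_upper)

lemma ell_tau_normI:
  assumes "\<And>n. tau_norm normY n x \<le> B"
  shows "x \<in> ell_tau normY" "ell_tau_norm normY x \<le> B"
proof -
  have "bdd_above (range (\<lambda>n. tau_norm normY n x))" using assms by (rule bdd_aboveI2)
  then show "x \<in> ell_tau normY" by (simp add: ell_tau_def)
  show "ell_tau_norm normY x \<le> B"
    unfolding ell_tau_norm_def using assms by (intro cSUP_least) auto
qed

lemma ell_tau_norm_nonneg: "x \<in> ell_tau normY \<Longrightarrow> 0 \<le> ell_tau_norm normY x"
  using tau_norm_le_ell_tau_norm[of x 0] tau_norm_nonneg[of 0 x] by linarith

lemma ell_tau_diff:
  assumes "x \<in> ell_tau normY" "y \<in> ell_tau normY"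
  shows "(\<lambda>j. x j - y j) \<in> ell_tau normY"
    and "ell_tau_norm normY (\<lambda>j. x j - y j) \<le> ell_tau_norm normY x + ell_tau_norm normY y"
proof -
  have "tau_norm normY n (\<lambda>j. x j - y j) \<le> ell_tau_norm normY x + ell_tau_norm normY y" for n
    using tau_norm_diff_le[of n x y] tau_norm_le_ell_tau_norm[OF assms(1), of n]
      tau_norm_le_ell_tau_norm[OF assms(2), of n] by linarith
  from ell_tau_normI[OF this] show "(\<lambda>j. x j - y j) \<in> ell_tau normY"
    and "ell_tau_norm normY (\<lambda>j. x j - y j) \<le> ell_tau_norm normY x + ell_tau_norm normY y" .
qed

text \<open>The supremum is attained at \<open>n\<close>: shorter tuples have smaller norm, longer
  ones merely append zeros.\<close>

lemma ell_tau_eventually_zero: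
  assumes "\<And>j. j \<ge> n \<Longrightarrow> x j = 0"
  shows "x \<in> ell_tau normY" "ell_tau_norm normY x = tau_norm normY n x"
proof -
  have "tau_norm normY m x \<le> tau_norm normY n x" for m
    using tau_norm_eventually_zero[of n m x] tau_norm_mono[of m n x] assms by (cases "n \<le> m") auto
  note * = ell_tau_normI[OF this]
  show "x \<in> ell_tau normY" by (rule *)
  then show "ell_tau_norm normY x = tau_norm normY n x"
    using *(2) tau_norm_le_ell_tau_norm[of x n] by simp
qed

lemma ell_tau_norm_zero: "ell_tau_norm normY (\<lambda>j. 0 :: 'x::banach_lattice) = 0"
  by (simp add: ell_tau_norm_def tau_norm_zero)

lemma ell0_eventually_zero:
  assumes "\<And>j. j \<ge> n \<Longrightarrow> w j = 0"
  shows "w \<in> ell0 Y normY"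
proof -
  have "\<forall>\<^sub>F j in sequentially. w j = 0" using assms by (auto simp: eventually_sequentially)
  moreover have "ell_norm normY (\<lambda>j. w j - w j) = 0" by (simp add: ell_norm_def norm_zero)
  ultimately show ?thesis
    using ell_eventually_zero(1)[OF assms] unfolding ell0_def closure_eventually_zero_def by auto
qed

lemma ell0_tau_eventually_zero:
  assumes "\<And>j. j \<ge> n \<Longrightarrow> x j = 0"
  shows "x \<in> ell0_tau normY"
proof -
  have "\<forall>\<^sub>F j in sequentially. x j = 0" using assms by (auto simp: eventually_sequentially)
  moreover have "ell_tau_norm normY (\<lambda>j. x j - x j) = 0" by (simp add: ell_tau_norm_zero)
  ultimately show ?thesis
    using ell_tau_eventually_zero(1)[OF assms] unfolding ell0_tau_def closure_eventually_zero_def by auto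
qed

text \<open>Needed because the estimate for concave operators is available on
  \<open>ell0_tau\<close> only, and has to be applied to x - v. If \<open>u\<close> approximates
  \<open>x\<close>, then u - v approximates x - v.\<close>

lemma ell0_tau_diff:
  assumes x: "x \<in> ell0_tau normY" and v: "v \<in> ell_tau normY" "\<forall>\<^sub>F j in sequentially. v j = 0"
  shows "(\<lambda>j. x j - v j) \<in> ell0_tau normY"
proof -
  have "\<exists>u\<in>ell_tau normY. (\<forall>\<^sub>F j in sequentially. u j = 0) \<and>
      ell_tau_norm normY (\<lambda>j. x j - v j - u j) < \<epsilon>" if "\<epsilon> > 0" for \<epsilon>
  proof -
    obtain u where u: "u \<in> ell_tau normY" "\<forall>\<^sub>F j in sequentially. u j = 0"
        "ell_tau_norm normY (\<lambda>j. x j - u j) < \<epsilon>"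
      using x \<open>\<epsilon> > 0\<close> unfolding ell0_tau_def closure_eventually_zero_def by blast
    have "\<forall>\<^sub>F j in sequentially. u j - v j = 0"
      using u(2) v(2) by eventually_elim simp
    then show ?thesis
      using u(3) ell_tau_diff(1)[OF u(1) v(1)] by (intro bexI[of _ "\<lambda>j. u j - v j"]) auto
  qed
  moreover have "(\<lambda>j. x j - v j) \<in> ell_tau normY"
    using x v(1) by (intro ell_tau_diff) (simp_all add: ell0_tau_def closure_eventually_zero_def)
  ultimately show ?thesis unfolding ell0_tau_def closure_eventually_zero_def by simp
qed

section \<open>Convex operators\<close>

text \<open>The estimate holds on all of \<open>ell Y\<close>, as the norm of the image is a
  supremum over tuples. Applied to differences, it carries eventually zero approximants of
  \<open>w\<close> to those of the image. Keeping the same \<open>C\<close> on both sides prepares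
  the equality of norms.\<close>

lemma Y_convex_bound_iff:
  fixes T :: "'e::banach \<Rightarrow> 'x::banach_lattice"
  assumes "linear T"
  shows "Y_convex_bound normY T C \<longleftrightarrow> C > 0 \<and> seq_op T ` ell0 Y normY \<subseteq> ell0_tau normY \<and>
    (\<forall>w\<in>ell0 Y normY. ell_tau_norm normY (seq_op T w) \<le> C * ell_norm normY w)"
proof
  assume C: "Y_convex_bound normY T C"
  then have "C > 0" by (simp add: Y_convex_bound_def)
  have bound: "seq_op T w \<in> ell_tau normY" "ell_tau_norm normY (seq_op T w) \<le> C * ell_norm normY w"
    if "w \<in> ell Y" for w
  proof -
    have "tau_norm normY n (seq_op T w) \<le> C * ell_norm normY w" for n
    proof -
      have "tau_norm normY n (seq_op T w) \<le> C * tuple_norm normY n w"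
        using C by (simp add: Y_convex_bound_def seq_op_def)
      also have "\<dots> \<le> C * ell_norm normY w"
        using tuple_norm_le_ell_norm[OF that] \<open>C > 0\<close> by (intro mult_left_mono) auto
      finally show ?thesis .
    qed
    from ell_tau_normI[OF this] show "seq_op T w \<in> ell_tau normY"
      and "ell_tau_norm normY (seq_op T w) \<le> C * ell_norm normY w" .
  qed
  have "seq_op T w \<in> ell0_tau normY" if w: "w \<in> ell0 Y normY" for w
  proof -
    have wY: "w \<in> ell Y" using w by (simp add: ell0_def closure_eventually_zero_def)
    have "\<exists>v\<in>ell_tau normY. (\<forall>\<^sub>F j in sequentially. v j = 0) \<and>
        ell_tau_norm normY (\<lambda>j. seq_op T w j - v j) < \<epsilon>" if "\<epsilon> > 0" for \<epsilon>
    proof -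
      have "\<epsilon> / C > 0" using \<open>\<epsilon> > 0\<close> \<open>C > 0\<close> by simp
      then obtain v where v: "v \<in> ell Y" "\<forall>\<^sub>F j in sequentially. v j = 0"
          "ell_norm normY (\<lambda>j. w j - v j) < \<epsilon> / C"
        using w unfolding ell0_def closure_eventually_zero_def by blast
      have "\<forall>\<^sub>F j in sequentially. seq_op T v j = 0"
        using v(2) by eventually_elim (simp add: seq_op_def linear_0[OF assms])
      moreover have "seq_op T (\<lambda>j. w j - v j) = (\<lambda>j. seq_op T w j - seq_op T v j)"
        by (simp add: seq_op_def linear_diff[OF assms])
      then have "ell_tau_norm normY (\<lambda>j. seq_op T w j - seq_op T v j) \<le> C * ell_norm normY (\<lambda>j. w j - v j)"
        using bound(2)[OF ell_diff[OF wY v(1)]] by simp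
      moreover have "C * ell_norm normY (\<lambda>j. w j - v j) < \<epsilon>"
        using v(3) \<open>C > 0\<close> by (simp add: field_simps)
      ultimately show ?thesis
        using bound(1)[OF v(1)] by (intro bexI[of _ "seq_op T v"]) auto
    qed
    then show ?thesis using bound(1)[OF wY] by (simp add: ell0_tau_def closure_eventually_zero_def)
  qed
  then show "C > 0 \<and> seq_op T ` ell0 Y normY \<subseteq> ell0_tau normY \<and>
      (\<forall>w\<in>ell0 Y normY. ell_tau_norm normY (seq_op T w) \<le> C * ell_norm normY w)"
    using \<open>C > 0\<close> bound(2) by (auto simp: ell0_def closure_eventually_zero_def)
next
  assume C: "C > 0 \<and> seq_op T ` ell0 Y normY \<subseteq> ell0_tau normY \<and>
      (\<forall>w\<in>ell0 Y normY. ell_tau_norm normY (seq_op T w) \<le> C * ell_norm normY w)"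
  have "tau_norm normY n (\<lambda>j. T (w j)) \<le> C * tuple_norm normY n w" for n w
  proof -
    \<comment> \<open>The tuple, padded with zeros, as an element of \<open>ell0\<close>.\<close>
    define v where "v = (\<lambda>j. if j < n then w j else 0)"
    have v: "v \<in> ell0 Y normY" by (rule ell0_eventually_zero[of n]) (simp add: v_def)
    have "tau_norm normY n (\<lambda>j. T (w j)) = tau_norm normY n (seq_op T v)"
      by (rule tau_norm_cong) (simp add: v_def seq_op_def)
    also have "\<dots> \<le> ell_tau_norm normY (seq_op T v)"
      using C v by (intro tau_norm_le_ell_tau_norm) (auto simp: ell0_tau_def closure_eventually_zero_def)
    also have "\<dots> \<le> C * ell_norm normY v" using C v by blast
    also have "ell_norm normY v = tuple_norm normY n v"
      by (rule ell_eventually_zero) (simp add: v_def)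
    also have "\<dots> = tuple_norm normY n w"
      unfolding tuple_norm_def v_def by (simp cong: if_cong)
    finally show ?thesis .
  qed
  then show "Y_convex_bound normY T C" using C by (simp add: Y_convex_bound_def)
qed

section \<open>Concave operators\<close>

text \<open>Completeness is applied to the scalar sequences \<open>F k\<close> of norms of the
  images of approximants, not to vector-valued ones: by the reverse triangle inequality
  \<open>F k\<close> - \<open>F l\<close> is dominated by the norms of the images of v k - v l, so
  \<open>F\<close> is Cauchy in \<open>Y\<close>.\<close>

lemma Y_concave_bound_ell:
  fixes S :: "'x::banach_lattice \<Rightarrow> 'e::banach"
  assumes S: "linear S" and K: "Y_concave_bound normY S K" and x: "x \<in> ell0_tau normY"
  shows "seq_op S x \<in> ell Y" "ell_norm normY (seq_op S x) \<le> K * ell_tau_norm normY x"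
proof -
  have "K > 0" and bound: "\<And>n x. tuple_norm normY n (seq_op S x) \<le> K * tau_norm normY n x"
    using K by (simp_all add: Y_concave_bound_def seq_op_def)
  have xT: "x \<in> ell_tau normY" using x by (simp add: ell0_tau_def closure_eventually_zero_def)
  have "\<exists>v\<in>ell_tau normY. (\<forall>\<^sub>F j in sequentially. v j = 0) \<and>
      ell_tau_norm normY (\<lambda>j. x j - v j) < inverse (real (Suc k))" for k
    using x unfolding ell0_tau_def closure_eventually_zero_def by simp
  then obtain v where v: "\<And>k. v k \<in> ell_tau normY" "\<And>k. \<forall>\<^sub>F j in sequentially. v k j = 0"
      "\<And>k. ell_tau_norm normY (\<lambda>j. x j - v k j) < inverse (real (Suc k))"
    by metis
  have fin: "seq_op S u \<in> ell Y" "ell_norm normY (seq_op S u) \<le> K * ell_tau_norm normY u"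
    if u: "\<forall>\<^sub>F j in sequentially. u j = 0" for u
  proof -
    obtain n where n: "\<And>j. j \<ge> n \<Longrightarrow> u j = 0" using u by (auto simp: eventually_sequentially)
    then have Sn: "\<And>j. j \<ge> n \<Longrightarrow> seq_op S u j = 0" by (simp add: seq_op_def linear_0[OF S])
    show "seq_op S u \<in> ell Y" using Sn by (rule ell_eventually_zero)
    show "ell_norm normY (seq_op S u) \<le> K * ell_tau_norm normY u"
      using bound[of n u] ell_eventually_zero(2)[OF Sn] ell_tau_eventually_zero(2)[OF n] by simp
  qed
  define F where "F k = (\<lambda>j. norm (S (v k j)))" for k
  have FY: "F k \<in> Y" for k
    using fin(1)[OF v(2)] by (simp add: F_def ell_def seq_op_def)
  have Fnorm: "normY (F k) \<le> K * (inverse (real (Suc k)) + ell_tau_norm normY x)" for k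
  proof -
    have "normY (F k) \<le> K * ell_tau_norm normY (v k)"
      using fin(2)[OF v(2)] by (simp add: F_def ell_norm_def seq_op_def)
    \<comment> \<open>Write v k as x - (x - v k); likewise v k - v l is written below as (x - v l) -
      (x - v k), so that \<open>ell_tau_diff\<close> applies.\<close>
    also have "ell_tau_norm normY (v k) \<le> ell_tau_norm normY x + ell_tau_norm normY (\<lambda>j. x j - v k j)"
      using ell_tau_diff(2)[OF xT ell_tau_diff(1)[OF xT v(1)[of k]]] by simp
    finally show ?thesis using \<open>K > 0\<close> v(3)[of k] by (simp add: order_trans)
  qed
  have Fdiff: "normY (\<lambda>j. F k j - F l j) \<le> K * (inverse (real (Suc k)) + inverse (real (Suc l)))" for k l
  proof -
    let ?u = "\<lambda>j. v k j - v l j"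
    have "\<forall>\<^sub>F j in sequentially. ?u j = 0"
      using v(2)[of k] v(2)[of l] by eventually_elim simp
    note u = fin[OF this]
    have "normY (\<lambda>j. F k j - F l j) \<le> normY (\<lambda>j. norm (seq_op S ?u j))"
      using u(1) unfolding ell_def
      by (intro solid_norm) (simp_all add: F_def seq_op_def linear_diff[OF S] norm_triangle_ineq3)
    also have "\<dots> \<le> K * ell_tau_norm normY ?u" using u(2) by (simp add: ell_norm_def)
    also have "ell_tau_norm normY ?u \<le>
        ell_tau_norm normY (\<lambda>j. x j - v l j) + ell_tau_norm normY (\<lambda>j. x j - v k j)"
      using ell_tau_diff(2)[OF ell_tau_diff(1)[OF xT v(1)[of l]] ell_tau_diff(1)[OF xT v(1)[of k]]]
      by simp
    also have "\<dots> \<le> inverse (real (Suc k)) + inverse (real (Suc l))"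
      using v(3)[of k] v(3)[of l] by linarith
    finally show ?thesis using \<open>K > 0\<close> by simp
  qed
  have inv0: "(\<lambda>k. K * (2 * inverse (real (Suc k)))) \<longlonglongrightarrow> K * (2 * 0)"
    by (intro tendsto_intros LIMSEQ_inverse_real_of_nat)
  have "\<exists>M. \<forall>k\<ge>M. \<forall>l\<ge>M. normY (\<lambda>j. F k j - F l j) < \<epsilon>" if "\<epsilon> > 0" for \<epsilon>
  proof -
    have "\<forall>\<^sub>F k in sequentially. K * (2 * inverse (real (Suc k))) < \<epsilon>"
      using order_tendstoD(2)[OF inv0] \<open>\<epsilon> > 0\<close> by simp
    then obtain M where M: "K * (2 * inverse (real (Suc M))) < \<epsilon>"
      by (auto simp: eventually_sequentially)
    have "normY (\<lambda>j. F k j - F l j) < \<epsilon>" if "k \<ge> M" "l \<ge> M" for k l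
    proof -
      have "K * (inverse (real (Suc k)) + inverse (real (Suc l)))
          \<le> K * (inverse (real (Suc M)) + inverse (real (Suc M)))"
        using that \<open>K > 0\<close> by (intro mult_left_mono add_mono le_imp_inverse_le) auto
      then show ?thesis using Fdiff[of k l] M unfolding mult_2 by linarith
    qed
    then show ?thesis by blast
  qed
  then obtain g where g: "g \<in> Y" "(\<lambda>k. normY (\<lambda>j. F k j - g j)) \<longlonglongrightarrow> 0"
    using complete[of F] FY by blast
  have "g j = norm (S (x j))" for j
  proof -
    let ?c = "normY (\<lambda>i. if i = j then 1 else 0)"
    have lim: "(\<lambda>k. normY (\<lambda>j. F k j - g j) / ?c) \<longlonglongrightarrow> 0"
      using g(2) by (rule tendsto_divide_zero)
    have "norm (F k j - g j) \<le> normY (\<lambda>j. F k j - g j) / ?c" for k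
      using coordinate_le_norm[OF diff_mem[OF FY g(1)], of k j] unit_norm_pos[of j]
      by (simp add: pos_le_divide_eq)
    then have 1: "(\<lambda>k. F k j) \<longlonglongrightarrow> g j"
      using lim by (rule LIMSEQ_norm_diff_le)
    \<comment> \<open>Continuity of \<open>S\<close> is not assumed; concavity on tuples of length
      \<open>Suc j\<close>, the least containing the entry \<open>j\<close>, shows that S (v k j)
      tends to S (x j).\<close>
    have "norm (F k j - norm (S (x j))) \<le> K * inverse (real (Suc k)) / ?c" for k
    proof -
      let ?u = "\<lambda>i. x i - v k i"
      let ?f = "\<lambda>i. if i < Suc j then norm (seq_op S ?u i) else 0"
      have "?f \<in> Y" using finite_support_mem_norm_le[of "Suc j" ?f] by simp
      have "norm (S (?u j)) * ?c \<le> tuple_norm normY (Suc j) (seq_op S ?u)"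
        using coordinate_le_norm[OF \<open>?f \<in> Y\<close>, of j]
        by (simp add: tuple_norm_def seq_op_def cong: if_cong)
      also have "\<dots> \<le> K * tau_norm normY (Suc j) ?u" by (rule bound)
      also have "\<dots> \<le> K * ell_tau_norm normY ?u"
        using \<open>K > 0\<close> tau_norm_le_ell_tau_norm[OF ell_tau_diff(1)[OF xT v(1)]]
        by (intro mult_left_mono) auto
      also have "\<dots> \<le> K * inverse (real (Suc k))"
        using \<open>K > 0\<close> v(3)[of k] by (intro mult_left_mono) auto
      finally have "norm (S (?u j)) \<le> K * inverse (real (Suc k)) / ?c"
        using unit_norm_pos[of j] by (simp add: pos_le_divide_eq)
      moreover have "norm (F k j - norm (S (x j))) \<le> norm (S (?u j))"
        using norm_triangle_ineq3[of "S (x j)" "S (v k j)"]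
        by (simp add: F_def linear_diff[OF S] abs_minus_commute)
      ultimately show ?thesis by linarith
    qed
    moreover have "(\<lambda>k. K * inverse (real (Suc k)) / ?c) \<longlonglongrightarrow> 0"
      by (intro tendsto_divide_zero tendsto_mult_right_zero LIMSEQ_inverse_real_of_nat)
    ultimately have "(\<lambda>k. F k j) \<longlonglongrightarrow> norm (S (x j))"
      by (rule LIMSEQ_norm_diff_le)
    with 1 show ?thesis by (rule LIMSEQ_unique)
  qed
  then have g_eq: "g = (\<lambda>j. norm (seq_op S x j))" by (auto simp: seq_op_def)
  show "seq_op S x \<in> ell Y" using g(1) by (simp add: g_eq ell_def)
  \<comment> \<open>Both error terms tend to 0, so the limit retains the constant \<open>K\<close>
    itself.\<close>
  have "normY g \<le> normY (\<lambda>j. F k j - g j) + K * (inverse (real (Suc k)) + ell_tau_norm normY x)" for k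
    using norm_le_diff_add[OF g(1) FY[of k]] norm_minus_commute[OF g(1) FY[of k]] Fnorm[of k]
    by linarith
  moreover have "(\<lambda>k. normY (\<lambda>j. F k j - g j) + K * (inverse (real (Suc k)) + ell_tau_norm normY x))
      \<longlonglongrightarrow> 0 + K * (0 + ell_tau_norm normY x)"
    by (intro tendsto_intros g(2) LIMSEQ_inverse_real_of_nat)
  ultimately have "normY g \<le> 0 + K * (0 + ell_tau_norm normY x)"
    by (intro LIMSEQ_le_const) auto
  then show "ell_norm normY (seq_op S x) \<le> K * ell_tau_norm normY x"
    by (simp add: g_eq ell_norm_def)
qed

lemma Y_concave_bound_iff:
  fixes S :: "'x::banach_lattice \<Rightarrow> 'e::banach"
  assumes S: "linear S"
  shows "Y_concave_bound normY S K \<longleftrightarrow> K > 0 \<and> seq_op S ` ell0_tau normY \<subseteq> ell0 Y normY \<and>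
    (\<forall>x\<in>ell0_tau normY. ell_norm normY (seq_op S x) \<le> K * ell_tau_norm normY x)"
proof
  assume K: "Y_concave_bound normY S K"
  then have "K > 0" by (simp add: Y_concave_bound_def)
  note bound = Y_concave_bound_ell[OF S K]
  have "seq_op S x \<in> ell0 Y normY" if x: "x \<in> ell0_tau normY" for x
  proof -
    have "\<exists>w\<in>ell Y. (\<forall>\<^sub>F j in sequentially. w j = 0) \<and>
        ell_norm normY (\<lambda>j. seq_op S x j - w j) < \<epsilon>" if "\<epsilon> > 0" for \<epsilon>
    proof -
      have "\<epsilon> / K > 0" using \<open>\<epsilon> > 0\<close> \<open>K > 0\<close> by simp
      then obtain v where v: "v \<in> ell_tau normY" "\<forall>\<^sub>F j in sequentially. v j = 0"
          "ell_tau_norm normY (\<lambda>j. x j - v j) < \<epsilon> / K"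
        using x unfolding ell0_tau_def closure_eventually_zero_def by blast
      have ev: "\<forall>\<^sub>F j in sequentially. seq_op S v j = 0"
        using v(2) by eventually_elim (simp add: seq_op_def linear_0[OF S])
      have "seq_op S (\<lambda>j. x j - v j) = (\<lambda>j. seq_op S x j - seq_op S v j)"
        by (simp add: seq_op_def linear_diff[OF S])
      then have "ell_norm normY (\<lambda>j. seq_op S x j - seq_op S v j)
          \<le> K * ell_tau_norm normY (\<lambda>j. x j - v j)"
        using bound(2)[OF ell0_tau_diff[OF x v(1,2)]] by simp
      moreover have "K * ell_tau_norm normY (\<lambda>j. x j - v j) < \<epsilon>"
        using v(3) \<open>K > 0\<close> by (simp add: field_simps)
      moreover have "seq_op S v \<in> ell Y"
        using ev ell_eventually_zero(1) by (auto simp: eventually_sequentially)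
      ultimately show ?thesis
        using ev by (intro bexI[of _ "seq_op S v"]) auto
    qed
    then show ?thesis using bound(1)[OF x] by (simp add: ell0_def closure_eventually_zero_def)
  qed
  then show "K > 0 \<and> seq_op S ` ell0_tau normY \<subseteq> ell0 Y normY \<and>
      (\<forall>x\<in>ell0_tau normY. ell_norm normY (seq_op S x) \<le> K * ell_tau_norm normY x)"
    using \<open>K > 0\<close> bound(2) by auto
next
  assume K: "K > 0 \<and> seq_op S ` ell0_tau normY \<subseteq> ell0 Y normY \<and>
      (\<forall>x\<in>ell0_tau normY. ell_norm normY (seq_op S x) \<le> K * ell_tau_norm normY x)"
  have "tuple_norm normY n (\<lambda>j. S (x j)) \<le> K * tau_norm normY n x" for n x
  proof -
    define v where "v = (\<lambda>j. if j < n then x j else 0)"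
    have v: "v \<in> ell0_tau normY" by (rule ell0_tau_eventually_zero[of n]) (simp add: v_def)
    have "tuple_norm normY n (\<lambda>j. S (x j)) = tuple_norm normY n (seq_op S v)"
      unfolding tuple_norm_def v_def seq_op_def by (simp cong: if_cong)
    also have "\<dots> = ell_norm normY (seq_op S v)"
      by (rule ell_eventually_zero(2)[symmetric]) (simp add: v_def seq_op_def linear_0[OF S])
    also have "\<dots> \<le> K * ell_tau_norm normY v" using K v by blast
    also have "ell_tau_norm normY v = tau_norm normY n v"
      by (rule ell_tau_eventually_zero) (simp add: v_def)
    also have "\<dots> = tau_norm normY n x"
      by (rule tau_norm_cong) (simp add: v_def)
    finally show ?thesis .
  qed
  then show "Y_concave_bound normY S K" using K by (simp add: Y_concave_bound_def)
qed

end

section \<open>From admissible constants to operator norms\<close>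

text \<open>Common to both halves: \<open>P C\<close> stands for being a convexity or concavity
  constant. Such constants are positive whereas a bound in \<open>bounded_between\<close> may be any
  real, hence the passage to \<open>max K 1\<close>.\<close>

lemma bounded_between_op_norm:
  assumes P: "\<And>C. P C \<longleftrightarrow> C > 0 \<and> F ` A \<subseteq> B \<and> (\<forall>a\<in>A. NB (F a) \<le> C * NA a)"
    and nonneg: "\<And>a. a \<in> A \<Longrightarrow> 0 \<le> NA a" "\<And>b. b \<in> B \<Longrightarrow> 0 \<le> NB b" and "A \<noteq> {}"
  shows "(\<exists>C. P C) \<longleftrightarrow> bounded_between A NA B NB F"
    and "\<exists>C. P C \<Longrightarrow> op_norm A NA NB F = Inf {C. P C}"
proof -
  show "(\<exists>C. P C) \<longleftrightarrow> bounded_between A NA B NB F"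
  proof
    assume "bounded_between A NA B NB F"
    then obtain K where K: "F ` A \<subseteq> B" "\<And>a. a \<in> A \<Longrightarrow> NB (F a) \<le> K * NA a"
      by (auto simp: bounded_between_def)
    have "NB (F a) \<le> max K 1 * NA a" if "a \<in> A" for a
      using K(2)[OF that] nonneg(1)[OF that] by (meson max.cobounded1 mult_right_mono order_trans)
    then have "P (max K 1)" using K(1) by (simp add: P)
    then show "\<exists>C. P C" ..
  qed (auto simp: P bounded_between_def)
next
  assume "\<exists>C. P C"
  then obtain C0 where C0: "P C0" ..
  \<comment> \<open>If NA a = 0, the quotient is 0 by the convention for division by zero, and C >
    0.\<close>
  have ratio: "NB (F a) / NA a \<le> C" if "P C" "a \<in> A" for C a
  proof (cases "NA a = 0")
    case False
    then have "NA a > 0" using nonneg(1)[OF that(2)] by simp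
    then show ?thesis using that by (simp add: P pos_divide_le_eq)
  qed (use that in \<open>simp add: P\<close>)
  let ?s = "SUP a\<in>A. NB (F a) / NA a"
  have bdd: "bdd_above ((\<lambda>a. NB (F a) / NA a) ` A)"
    using ratio[OF C0] by (rule bdd_aboveI2)
  have upper: "NB (F a) / NA a \<le> ?s" if "a \<in> A" for a
    using bdd that by (rule cSUP_upper2) simp
  obtain a0 where a0: "a0 \<in> A" using \<open>A \<noteq> {}\<close> by blast
  have "0 \<le> NB (F a0) / NA a0" using a0 C0 nonneg by (auto simp: P)
  then have s0: "0 \<le> ?s" using upper[OF a0] by linarith
  \<comment> \<open>The supremum itself may be 0, as for the zero operator, while \<open>P\<close>
    requires a positive constant; hence \<epsilon>. Where NA a = 0 the quotient says nothing, and
    the known constant \<open>C0\<close> forces NB (F a) \<le> 0.\<close>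
  have bound: "P (?s + \<epsilon>)" if "\<epsilon> > 0" for \<epsilon>
    unfolding P
  proof (intro conjI ballI)
    fix a assume a: "a \<in> A"
    show "NB (F a) \<le> (?s + \<epsilon>) * NA a"
    proof (cases "NA a = 0")
      case True
      then show ?thesis using C0 a by (auto simp: P)
    next
      case False
      then have pos: "NA a > 0" using nonneg(1)[OF a] by simp
      have "NB (F a) / NA a \<le> ?s + \<epsilon>" using upper[OF a] \<open>\<epsilon> > 0\<close> by linarith
      then show ?thesis using pos by (simp add: pos_divide_le_eq)
    qed
  qed (use C0 s0 that in \<open>auto simp: P\<close>)
  have "Inf {C. P C} \<le> ?s + \<epsilon>" if "\<epsilon> > 0" for \<epsilon>
    using bound[OF that] by (intro cInf_lower) (auto simp: P intro!: bdd_belowI[of _ 0])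
  then have "Inf {C. P C} \<le> ?s" by (rule field_le_epsilon)
  moreover have "?s \<le> Inf {C. P C}"
  proof (rule cInf_greatest)
    fix C assume "C \<in> {C. P C}"
    then show "?s \<le> C" using ratio \<open>A \<noteq> {}\<close> by (intro cSUP_least) auto
  qed (use C0 in blast)
  ultimately show "op_norm A NA NB F = Inf {C. P C}" by (simp add: op_norm_def)
qed

theorem theorem24:
  fixes Y :: "(nat \<Rightarrow> real) set" and normY :: "(nat \<Rightarrow> real) \<Rightarrow> real"
  assumes "banach_sequence_lattice Y normY"
  shows
    "(\<forall>T :: 'e::banach \<Rightarrow> 'x::banach_lattice. linear T \<longrightarrow>
        (Y_convex normY T \<longleftrightarrow>
          bounded_between (ell0 Y normY) (ell_norm normY) (ell0_tau normY) (ell_tau_norm normY)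
            (seq_op T)) \<and>
        (Y_convex normY T \<longrightarrow>
          op_norm (ell0 Y normY) (ell_norm normY) (ell_tau_norm normY) (seq_op T)
            = Y_convex_const normY T)) \<and>
     (\<forall>S :: 'x \<Rightarrow> 'e. linear S \<longrightarrow>
        (Y_concave normY S \<longleftrightarrow>
          bounded_between (ell0_tau normY) (ell_tau_norm normY) (ell0 Y normY) (ell_norm normY)
            (seq_op S)) \<and>
        (Y_concave normY S \<longrightarrow>
          op_norm (ell0_tau normY) (ell_tau_norm normY) (ell_norm normY) (seq_op S)
            = Y_concave_const normY S))"
proof -
  interpret banach_sequence_lattice Y normY by fact
  have nonneg: "0 \<le> ell_norm normY w" if "w \<in> ell0 Y normY" for w :: "nat \<Rightarrow> 'e"
    using that by (simp add: ell0_def closure_eventually_zero_def ell_norm_nonneg)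
  have nonneg_tau: "0 \<le> ell_tau_norm normY x" if "x \<in> ell0_tau normY" for x :: "nat \<Rightarrow> 'x"
    using that by (simp add: ell0_tau_def closure_eventually_zero_def ell_tau_norm_nonneg)
  have nonempty: "ell0 Y normY \<noteq> ({} :: (nat \<Rightarrow> 'e) set)"
    using ell0_eventually_zero[of 0 "\<lambda>j. 0"] by auto
  have nonempty_tau: "ell0_tau normY \<noteq> ({} :: (nat \<Rightarrow> 'x) set)"
    using ell0_tau_eventually_zero[of 0 "\<lambda>j. 0"] by auto
  show ?thesis
    unfolding Y_convex_def Y_convex_const_def Y_concave_def Y_concave_const_def
    using bounded_between_op_norm[OF Y_convex_bound_iff nonneg nonneg_tau nonempty]
      bounded_between_op_norm[OF Y_concave_bound_iff nonneg_tau nonneg nonempty_tau]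
    by blast
qed

end
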